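(* Let $K^*,L^*\ge0$, let $\alpha^*_1,\dots,\alpha^*_{K^*}$ be distinct nonzero complex numbers, let $\beta^*_1,\dots,\beta^*_{L^*}$ be distinct nonzero complex numbers not on $\mathbb T$, let $n\ge L^*$, and let $\Phi_n,\Phi^*_n,\Xi_n,\Xi^*_n$ be the bi-orthogonal system of the weight $$\widehat w(z)=\frac{\prod_{j=1}^{K^*}(1-\alpha^*_jz^{-1})}{\prod_{j=1}^{L^*}(1-\beta^*_jz^{-1})}\,w(z).$$ For a sequence $a=(a_m)$ let $$v(a,z)=\big(a_{n-L^*}(z),\dots,a_{n-1}(z),a_n(z),z^{-1}a_{n+1}(z),\dots,z^{-K^*}a_{n+K^*}(z)\big),$$ and let $\det(v_0;\dots;v_N)$ be the determinant with rows $v_0,\dots,v_N$. Then there are constants $C,C^*$ independent of $z$ such that $$\prod_{j=1}^{K^*}(1-\alpha^*_jz^{-1})\,\Phi_n(z)=C\det\big(v(\phi,z);v(\phi,\alpha^*_1);\dots;v(\phi,\alpha^*_{K^*});(\beta^*_1)^{-n}v(\xi,\beta^*_1);\dots;(\beta^*_{L^*})^{-n}v(\xi,\beta^*_{L^*})\big),$$ $$\prod_{j=1}^{K^*}(1-\alpha^*_jz^{-1})\,\Phi^*_n(z)=C^*\det\big(v(\phi^*,z);v(\phi^*,\alpha^*_1);\dots;v(\phi^*,\alpha^*_{K^*});(\beta^*_1)^{-n}v(\xi^*,\beta^*_1);\dots;(\beta^*_{L^*})^{-n}v(\xi^*,\beta^*_{L^*})\big),$$ $$\prod_{j=1}^{L^*}(1-\beta^*_jz^{-1})\,\Xi_n(z)=C\det\big(v(\xi,z);v(\phi,\alpha^*_1);\dots;v(\phi,\alpha^*_{K^*});(\beta^*_1)^{-n}v(\xi,\beta^*_1);\dots;(\beta^*_{L^*})^{-n}v(\xi,\beta^*_{L^*})\big),$$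 $$\prod_{j=1}^{L^*}(1-\beta^*_jz^{-1})\,\Xi^*_n(z)=C^*\det\big(v(\xi^*,z);v(\phi^*,\alpha^*_1);\dots;v(\phi^*,\alpha^*_{K^*});(\beta^*_1)^{-n}v(\xi^*,\beta^*_1);\dots;(\beta^*_{L^*})^{-n}v(\xi^*,\beta^*_{L^*})\big).$$
   Context: $\mathbb T$ is the unit circle. For a complex-valued weight $w$ on $\mathbb T$ put $w_k=\int_{\mathbb T}\frac{d\zeta}{2\pi i\zeta}w(\zeta)\zeta^{-k}$ and $I_n[w]=\det[w_{j-k}]_{j,k=0,\dots,n-1}$, $I_0=1$. If $I_n[w]\ne0$ for all $n\ge0$, the bi-orthogonal system of $w$ is: polynomials $\phi_n,\bar\phi_n$ of degree $n$ with the same leading coefficient $\kappa_n$ satisfying $\int_{\mathbb T}\frac{d\zeta}{2\pi i\zeta}w(\zeta)\phi_m(\zeta)\bar\phi_n(\bar\zeta)=\delta_{m,n}$ with $\bar\zeta=1/\zeta$ ($\bar\phi_n$ is a separate polynomial, not in general the complex conjugate of $\phi_n$; $\kappa_n^2=I_n/I_{n+1}$, with a choice of square root $\kappa_n$ fixed); the reciprocal polynomial $\phi^*_n(z)=z^n\bar\phi_n(1/z)$; and the associated functions, for $z\notin\mathbb T$ and $n>0$, $\xi_n(z)=\int_{\mathbb T}\frac{d\zeta}{2\pi i\zeta}\frac{\zeta+z}{\zeta-z}w(\zeta)\phi_n(\zeta)$, $\ \xi^*_n(z)=-z^n\int_{\mathbb T}\frac{d\zeta}{2\pi i\zeta}\frac{\zeta+z}{\zeta-z}w(\zeta)\bar\phi_n(\bar\zeta)=\frac1{\kappa_n}-\int_{\mathbb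 T}\frac{d\zeta}{2\pi i\zeta}\frac{\zeta+z}{\zeta-z}w(\zeta)\phi^*_n(\zeta)$, and $\xi_0(z)=\kappa_0[w_0+F(z)]$, $\xi^*_0(z)=\kappa_0[w_0-F(z)]$ with $F(z)=\int_{\mathbb T}\frac{d\zeta}{2\pi i\zeta}\frac{\zeta+z}{\zeta-z}w(\zeta)$. Set $r_n=\phi_n(0)/\kappa_n$, $\bar r_n=\bar\phi_n(0)/\kappa_n$. The same definitions and normalisation applied to a modified weight $\widehat w$ give $\Phi_n,\bar\Phi_n,\Phi^*_n,\Xi_n,\Xi^*_n$, leading coefficient $\widehat\kappa_n$, and $\widehat r_n,\widehat{\bar r}_n$. Standing generic assumptions: both the original and the modified bi-orthogonal systems exist, and $r_n\bar r_n\ne0,1$, $\widehat r_n\widehat{\bar r}_n\ne0,1$ for all $n\ge1$. *)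

theory Defs
  imports "HOL-Complex_Analysis.Complex_Analysis" "Jordan_Normal_Form.Determinant"
begin

text \<open>The mean over the unit circle, that is, the integral against the normalised
  measure \<open>d\<zeta> / (2 \<pi> i \<zeta>)\<close>.\<close>

definition circle_int :: "(complex \<Rightarrow> complex) \<Rightarrow> complex" where
  "circle_int f =
     contour_integral (circlepath 0 1) (\<lambda>\<zeta>. f \<zeta> / (2 * complex_of_real pi * \<i> * \<zeta>))"

text \<open>A weight is a complex-valued function whose restriction to the circle is (Lebesgue) integrable.
  Without integrability the contour integrals above would be junk values.\<close>

definition circle_weight :: "(complex \<Rightarrow> complex) \<Rightarrow> bool" where
  "circle_weight w \<longleftrightarrow> (\<lambda>t. w (circlepath 0 1 t)) absolutely_integrable_on {0..1}"

definition fourier_coeff :: "(complex \<Rightarrow> complex) \<Rightarrow> int \<Rightarrow> complex" where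
  "fourier_coeff w k = circle_int (\<lambda>\<zeta>. w \<zeta> * \<zeta> powi (- k))"

definition toeplitz_det :: "(complex \<Rightarrow> complex) \<Rightarrow> nat \<Rightarrow> complex" where
  "toeplitz_det w n =
     Determinant.det (Matrix.mat n n (\<lambda>(j, k). fourier_coeff w (int j - int k)))"

text \<open>The second family \<open>\<phi>b\<close> is a separate sequence of polynomials, not the conjugate of \<open>\<phi>\<close>. The
  conditions determine a system up to the sign of each common leading coefficient, i.e. up to the
  choice of the square root of \<open>I\<^sub>n / I\<^sub>n\<^sub>+\<^sub>1\<close>.\<close>

definition biorthogonal_system ::
  "(complex \<Rightarrow> complex) \<Rightarrow> (nat \<Rightarrow> complex poly) \<Rightarrow> (nat \<Rightarrow> complex poly) \<Rightarrow> bool" where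
  "biorthogonal_system w \<phi> \<phi>b \<longleftrightarrow>
     (\<forall>n. toeplitz_det w n \<noteq> 0) \<and>
     (\<forall>n. degree (\<phi> n) = n \<and> degree (\<phi>b n) = n \<and> lead_coeff (\<phi> n) = lead_coeff (\<phi>b n)) \<and>
     (\<forall>m n. circle_int (\<lambda>\<zeta>. w \<zeta> * poly (\<phi> m) \<zeta> * poly (\<phi>b n) (1 / \<zeta>)) =
              (if m = n then 1 else 0))"

text \<open>Since \<open>\<phi>b n\<close> has degree \<open>n\<close>, its reflected polynomial is \<open>z\<^sup>n \<phi>b\<^sub>n(1/z)\<close>, also when the
  constant coefficient of \<open>\<phi>b n\<close> vanishes.\<close>

definition reciprocal :: "(nat \<Rightarrow> complex poly) \<Rightarrow> nat \<Rightarrow> complex poly" where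
  "reciprocal \<phi>b n = reflect_poly (\<phi>b n)"

lemma poly_reciprocal:
  assumes "biorthogonal_system w \<phi> \<phi>b" "z \<noteq> 0"
  shows "poly (reciprocal \<phi>b n) z = z ^ n * poly (\<phi>b n) (1 / z)"
  using assms
  by (simp add: reciprocal_def biorthogonal_system_def poly_reflect_poly_nz inverse_eq_divide)

definition caratheodory :: "(complex \<Rightarrow> complex) \<Rightarrow> complex \<Rightarrow> complex" where
  "caratheodory w z = circle_int (\<lambda>\<zeta>. (\<zeta> + z) / (\<zeta> - z) * w \<zeta>)"

definition assoc ::
  "(complex \<Rightarrow> complex) \<Rightarrow> (nat \<Rightarrow> complex poly) \<Rightarrow> nat \<Rightarrow> complex \<Rightarrow> complex" where
  "assoc w \<phi> n z =
     (if n = 0 then lead_coeff (\<phi> 0) * (fourier_coeff w 0 + caratheodory w z)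
      else circle_int (\<lambda>\<zeta>. (\<zeta> + z) / (\<zeta> - z) * w \<zeta> * poly (\<phi> n) \<zeta>))"

definition assoc_star ::
  "(complex \<Rightarrow> complex) \<Rightarrow> (nat \<Rightarrow> complex poly) \<Rightarrow> nat \<Rightarrow> complex \<Rightarrow> complex" where
  "assoc_star w \<phi>b n z =
     (if n = 0 then lead_coeff (\<phi>b 0) * (fourier_coeff w 0 - caratheodory w z)
      else - (z ^ n) * circle_int (\<lambda>\<zeta>. (\<zeta> + z) / (\<zeta> - z) * w \<zeta> * poly (\<phi>b n) (1 / \<zeta>)))"

definition refl_coeff :: "(nat \<Rightarrow> complex poly) \<Rightarrow> nat \<Rightarrow> complex" where
  "refl_coeff p n = poly (p n) 0 / lead_coeff (p n)"

definition generic_system :: "(nat \<Rightarrow> complex poly) \<Rightarrow> (nat \<Rightarrow> complex poly) \<Rightarrow> bool" where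
  "generic_system \<phi> \<phi>b \<longleftrightarrow>
     (\<forall>n\<ge>1. refl_coeff \<phi> n * refl_coeff \<phi>b n \<noteq> 0 \<and> refl_coeff \<phi> n * refl_coeff \<phi>b n \<noteq> 1)"

definition node_prod :: "nat \<Rightarrow> (nat \<Rightarrow> complex) \<Rightarrow> complex \<Rightarrow> complex" where
  "node_prod N a z = (\<Prod>j=1..N. 1 - a j / z)"

definition modified_weight ::
  "nat \<Rightarrow> nat \<Rightarrow> (nat \<Rightarrow> complex) \<Rightarrow> (nat \<Rightarrow> complex) \<Rightarrow> (complex \<Rightarrow> complex) \<Rightarrow> complex \<Rightarrow> complex" where
  "modified_weight K L \<alpha> \<beta> w z = node_prod K \<alpha> z / node_prod L \<beta> z * w z"

text \<open>The row \<open>v(a,z)\<close> of length \<open>K + L + 1\<close>, for \<open>L \<le> n\<close>: entry \<open>i\<close> belongs to the index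
  \<open>n - L + i\<close>, and the factors \<open>z\<^sup>-\<^sup>1, \<dots>, z\<^sup>-\<^sup>K\<close> only occur at the last \<open>K\<close> entries.\<close>

definition det_row ::
  "nat \<Rightarrow> nat \<Rightarrow> nat \<Rightarrow> (nat \<Rightarrow> complex \<Rightarrow> complex) \<Rightarrow> complex \<Rightarrow> complex Matrix.vec" where
  "det_row K L n a z =
     Matrix.vec (K + L + 1)
       (\<lambda>i. if i \<le> L then a (n - L + i) z else z powi (- int (i - L)) * a (n - L + i) z)"

text \<open>Rows: \<open>v(a,z)\<close>, then \<open>v(p,\<alpha>\<^sub>j)\<close>, then \<open>\<beta>\<^sub>j\<^sup>-\<^sup>n v(q,\<beta>\<^sub>j)\<close>.\<close>

definition row_det ::
  "nat \<Rightarrow> nat \<Rightarrow> nat \<Rightarrow> (nat \<Rightarrow> complex) \<Rightarrow> (nat \<Rightarrow> complex) \<Rightarrow>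
   (nat \<Rightarrow> complex \<Rightarrow> complex) \<Rightarrow> (nat \<Rightarrow> complex \<Rightarrow> complex) \<Rightarrow>
   (nat \<Rightarrow> complex \<Rightarrow> complex) \<Rightarrow> complex \<Rightarrow> complex" where
  "row_det K L n \<alpha> \<beta> p q a z =
     Determinant.det (mat_of_rows (K + L + 1)
       ([det_row K L n a z]
        @ map (\<lambda>j. det_row K L n p (\<alpha> j)) [1..<K+1]
        @ map (\<lambda>j. \<beta> j powi (- int n) \<cdot>\<^sub>v det_row K L n q (\<beta> j)) [1..<L+1]))"

end

theory Submission
  imports Defs
begin

text \<open>
  Write \<open>A\<close>, \<open>B\<close> for the products over the \<open>\<alpha>\<^sub>j\<close>, \<open>\<beta>\<^sub>j\<close>. Let \<open>f\<close> be a combination of the entries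
  of \<open>v(\<phi>, z)\<close> that is annihilated by the lower rows of the determinant. Vanishing at the \<open>\<alpha>\<^sub>j\<close> makes
  \<open>f / A\<close> a polynomial of degree at most \<open>n\<close>. The same combination of the \<open>\<xi>\<close> entries is twice the
  integral of \<open>w f \<zeta> / (\<zeta> - z)\<close>, and its vanishing at the \<open>\<beta>\<^sub>j\<close> makes \<open>w f / B\<close> orthogonal to
  \<open>\<zeta>\<^sup>k\<close> for \<open>0 \<le> k < n\<close>. Hence \<open>f / A\<close> is a multiple of \<open>\<Phi>\<^sub>n\<close>. The entries of \<open>v(\<phi>, z)\<close> are
  linearly independent because every \<open>\<phi>\<^sub>m\<close> has exact degree \<open>m\<close> and nonzero constant term, so the
  multiple is nonzero for the combination given by the cofactors of the first row. The starred case
  is the unstarred one with \<open>w(\<zeta>)\<close> replaced by \<open>w(\<zeta>) / \<zeta>\<close> and \<open>\<phi>\<close> by \<open>\<phi>\<^sup>*\<close>.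
\<close>

section \<open>Integrals over the unit circle\<close>

text \<open>The derivative of the parametrisation cancels the denominator of the measure, so the
  mean becomes an integral over \<open>{0..1}\<close>, to which linearity and absolute integrability
  apply directly.\<close>

lemma circle_int_eq_integral: "circle_int f = integral {0..1} (\<lambda>t. f (circlepath 0 1 t))"
proof -
  have "f (circlepath 0 1 t) / (2 * complex_of_real pi * \<i> * circlepath 0 1 t) *
      vector_derivative (circlepath 0 1) (at t) = f (circlepath 0 1 t)" for t :: real
    by (simp add: vector_derivative_circlepath) (simp add: circlepath)
  then show ?thesis
    by (simp add: circle_int_def contour_integral_integral)
qed

lemma circlepath_in_sphere: "circlepath 0 1 t \<in> sphere (0::complex) 1"
  by (simp add: circlepath norm_mult norm_exp_eq_Re)

lemma circle_int_cong:
  assumes "\<And>\<zeta>. \<zeta> \<in> sphere 0 1 \<Longrightarrow> f \<zeta> = g \<zeta>"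
  shows "circle_int f = circle_int g"
  using assms circlepath_in_sphere by (simp add: circle_int_eq_integral)

lemma circle_weight_cong:
  assumes "circle_weight f" "\<And>\<zeta>. \<zeta> \<in> sphere 0 1 \<Longrightarrow> f \<zeta> = g \<zeta>"
  shows "circle_weight g"
  using assms circlepath_in_sphere by (simp add: circle_weight_def)

text \<open>A continuous function on the compact circle is bounded and measurable, which keeps the
  product integrable. The kernels, polynomials and node products below enter as such
  factors.\<close>

lemma circle_weight_mult:
  assumes u: "circle_weight u" and h: "continuous_on (sphere 0 1) h"
  shows "circle_weight (\<lambda>\<zeta>. u \<zeta> * h \<zeta>)"
proof -
  have p: "continuous_on {0..1} (circlepath (0::complex) 1)"
    using path_def by force
  have c: "continuous_on {0..1} (\<lambda>t. h (circlepath 0 1 t))"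
    using circlepath_in_sphere by (intro continuous_on_compose2[OF h p]) blast
  have "(\<lambda>t. h (circlepath 0 1 t) * u (circlepath 0 1 t)) absolutely_integrable_on {0..1}"
  proof (rule absolutely_integrable_bounded_measurable_product[where h = "(*)"])
    show "bilinear ((*) :: complex \<Rightarrow> complex \<Rightarrow> complex)"
      by (rule bilinear_times)
    show "(\<lambda>t. h (circlepath 0 1 t)) \<in> borel_measurable (lebesgue_on {0..1})"
      by (rule continuous_imp_measurable_on_sets_lebesgue[OF c]) simp
    show "bounded ((\<lambda>t. h (circlepath 0 1 t)) ` {0..1})"
      by (intro compact_imp_bounded compact_continuous_image c) simp
  qed (use u in \<open>auto simp: circle_weight_def\<close>)
  then show ?thesis
    by (simp add: circle_weight_def mult.commute)
qed

lemma circle_weight_cmult: "circle_weight u \<Longrightarrow> circle_weight (\<lambda>\<zeta>. c * u \<zeta>)"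
  using circle_weight_mult[of u "\<lambda>_. c"] by (simp add: mult.commute)

lemma circle_weight_add:
  "circle_weight u \<Longrightarrow> circle_weight v \<Longrightarrow> circle_weight (\<lambda>\<zeta>. u \<zeta> + v \<zeta>)"
  by (simp add: circle_weight_def set_integral_add)

lemma circle_weight_sum:
  "(\<And>i. i \<in> I \<Longrightarrow> circle_weight (u i)) \<Longrightarrow> circle_weight (\<lambda>\<zeta>. \<Sum>i\<in>I. u i \<zeta>)"
proof (induction I rule: infinite_finite_induct)
  case (insert i I)
  then show ?case by (simp add: circle_weight_add)
qed (simp_all add: circle_weight_def)

lemma integrable_circle_weight:
  "circle_weight u \<Longrightarrow> (\<lambda>t. u (circlepath 0 1 t)) integrable_on {0..1}"
  by (simp add: circle_weight_def set_lebesgue_integral_eq_integral(1))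

lemma circle_int_cmult: "circle_int (\<lambda>\<zeta>. c * u \<zeta>) = c * circle_int u"
  by (simp add: circle_int_eq_integral)

lemma circle_int_add:
  "circle_weight u \<Longrightarrow> circle_weight v \<Longrightarrow>
    circle_int (\<lambda>\<zeta>. u \<zeta> + v \<zeta>) = circle_int u + circle_int v"
  by (simp add: circle_int_eq_integral integral_add integrable_circle_weight)

lemma circle_int_diff:
  "circle_weight u \<Longrightarrow> circle_weight v \<Longrightarrow>
    circle_int (\<lambda>\<zeta>. u \<zeta> - v \<zeta>) = circle_int u - circle_int v"
  by (simp add: circle_int_eq_integral integral_diff integrable_circle_weight)

lemma circle_int_sum:
  assumes "finite I" "\<And>i. i \<in> I \<Longrightarrow> circle_weight (u i)"
  shows "circle_int (\<lambda>\<zeta>. \<Sum>i\<in>I. u i \<zeta>) = (\<Sum>i\<in>I. circle_int (u i))"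
  using assms by (simp add: circle_int_eq_integral integral_sum integrable_circle_weight)

lemma sphere_nonzero: "\<zeta> \<in> sphere (0::complex) 1 \<Longrightarrow> \<zeta> \<noteq> 0"
  by auto

section \<open>Orthogonality to powers and Cauchy transforms\<close>

text \<open>On the circle \<open>1 / \<zeta>\<close> is the conjugate of \<zeta>, so this is
  orthogonality to the first \<open>m\<close> powers of \<zeta>.\<close>

definition ortho :: "(complex \<Rightarrow> complex) \<Rightarrow> nat \<Rightarrow> bool" where
  "ortho u m \<longleftrightarrow> (\<forall>k<m. circle_int (\<lambda>\<zeta>. u \<zeta> * (1 / \<zeta>) ^ k) = 0)"

text \<open>The factor \<zeta> in the kernel cancels that of the measure: this is the usual Cauchy
  transform with kernel \<open>1 / (\<zeta> - z)\<close>.\<close>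

definition cauchy :: "(complex \<Rightarrow> complex) \<Rightarrow> complex \<Rightarrow> complex" where
  "cauchy u z = circle_int (\<lambda>\<zeta>. u \<zeta> * (\<zeta> / (\<zeta> - z)))"

lemma ortho_cong:
  assumes "\<And>\<zeta>. \<zeta> \<in> sphere 0 1 \<Longrightarrow> u \<zeta> = v \<zeta>" shows "ortho u m = ortho v m"
  unfolding ortho_def using assms by (metis (no_types, lifting) circle_int_cong)

lemma cauchy_cong:
  assumes "\<And>\<zeta>. \<zeta> \<in> sphere 0 1 \<Longrightarrow> u \<zeta> = v \<zeta>" shows "cauchy u z = cauchy v z"
  unfolding cauchy_def using assms by (intro circle_int_cong) simp

lemma orthoD: "ortho u m \<Longrightarrow> k < m \<Longrightarrow> circle_int (\<lambda>\<zeta>. u \<zeta> * (1 / \<zeta>) ^ k) = 0"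
  by (simp add: ortho_def)

lemma ortho_mono: "ortho u m \<Longrightarrow> k \<le> m \<Longrightarrow> ortho u k"
  by (auto simp: ortho_def)

lemma circle_weight_mult_power_inverse:
  "circle_weight u \<Longrightarrow> circle_weight (\<lambda>\<zeta>. u \<zeta> * (1 / \<zeta>) ^ k)"
  by (erule circle_weight_mult) (auto intro!: continuous_intros)

lemma circle_weight_mult_cauchy_kernel:
  "circle_weight u \<Longrightarrow> z \<notin> sphere 0 1 \<Longrightarrow> circle_weight (\<lambda>\<zeta>. u \<zeta> * (\<zeta> / (\<zeta> - z)))"
  by (erule circle_weight_mult) (auto intro!: continuous_intros)

lemma circle_weight_mult_poly:
  "circle_weight u \<Longrightarrow> circle_weight (\<lambda>\<zeta>. u \<zeta> * poly p \<zeta>)"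
  by (erule circle_weight_mult) (auto intro!: continuous_intros)

lemma cauchy_cmult: "cauchy (\<lambda>\<zeta>. c * u \<zeta>) z = c * cauchy u z"
  using circle_int_cmult[of c "\<lambda>\<zeta>. u \<zeta> * (\<zeta> / (\<zeta> - z))"]
  by (simp add: cauchy_def mult.assoc)

lemma cauchy_sum:
  assumes "finite I" "\<And>i. i \<in> I \<Longrightarrow> circle_weight (u i)" "z \<notin> sphere 0 1"
  shows "cauchy (\<lambda>\<zeta>. \<Sum>i\<in>I. u i \<zeta>) z = (\<Sum>i\<in>I. cauchy (u i) z)"
proof -
  have "cauchy (\<lambda>\<zeta>. \<Sum>i\<in>I. u i \<zeta>) z = circle_int (\<lambda>\<zeta>. \<Sum>i\<in>I. u i \<zeta> * (\<zeta> / (\<zeta> - z)))"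
    unfolding cauchy_def by (simp only: sum_distrib_right)
  also have "\<dots> = (\<Sum>i\<in>I. cauchy (u i) z)"
    unfolding cauchy_def using assms
    by (intro circle_int_sum circle_weight_mult_cauchy_kernel) auto
  finally show ?thesis .
qed

text \<open>Since \<open>(1 / \<zeta>) * (\<zeta> / (\<zeta> - z)) = (1 / z) * (\<zeta> / (\<zeta> -
  z) - 1)\<close>, each factor \<open>1 / \<zeta>\<close> leaves as \<open>1 / z\<close> up to a
  moment of \<open>u\<close> that orthogonality annihilates. This is why \<phi> and \<xi> carry the
  same powers of \<open>1 / z\<close> in the determinant rows.\<close>

lemma cauchy_shift:
  assumes u: "circle_weight u" and z: "z \<notin> sphere 0 1" "z \<noteq> 0"
  shows "ortho u j \<Longrightarrow> cauchy (\<lambda>\<zeta>. u \<zeta> * (1 / \<zeta>) ^ j) z = cauchy u z / z ^ j"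
proof (induction j)
  case (Suc j)
  let ?v = "\<lambda>\<zeta>. u \<zeta> * (1 / \<zeta>) ^ j"
  have v: "circle_weight ?v" using u by (rule circle_weight_mult_power_inverse)
  have "cauchy (\<lambda>\<zeta>. u \<zeta> * (1 / \<zeta>) ^ Suc j) z =
      circle_int (\<lambda>\<zeta>. 1 / z * (?v \<zeta> * (\<zeta> / (\<zeta> - z)) - ?v \<zeta>))"
    unfolding cauchy_def
  proof (rule circle_int_cong)
    fix \<zeta> :: complex assume *: "\<zeta> \<in> sphere 0 1"
    then have "\<zeta> \<noteq> 0" "\<zeta> - z \<noteq> 0" using z by auto
    then have "1 / \<zeta> * (\<zeta> / (\<zeta> - z)) = 1 / z * (\<zeta> / (\<zeta> - z) - 1)"
      using z by (simp add: divide_simps)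
    then have "?v \<zeta> * (1 / \<zeta> * (\<zeta> / (\<zeta> - z))) = ?v \<zeta> * (1 / z * (\<zeta> / (\<zeta> - z) - 1))"
      by (rule arg_cong)
    then show "u \<zeta> * (1 / \<zeta>) ^ Suc j * (\<zeta> / (\<zeta> - z)) = 1 / z * (?v \<zeta> * (\<zeta> / (\<zeta> - z)) - ?v \<zeta>)"
      by (simp only: power_Suc right_diff_distrib mult.assoc mult.left_commute
          mult.commute mult_1_left mult_1_right)
  qed
  also have "\<dots> = 1 / z * (cauchy ?v z - circle_int ?v)"
    unfolding circle_int_cmult cauchy_def
    using circle_int_diff[OF circle_weight_mult_cauchy_kernel[OF v z(1)] v] by simp
  also have "\<dots> = cauchy u z / z ^ Suc j"
    using Suc orthoD[OF Suc.prems, of j] ortho_mono[OF Suc.prems, of j] by simp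
  finally show ?case .
qed simp

lemma circle_int_factor:
  assumes U: "circle_weight U"
  shows "circle_int (\<lambda>\<zeta>. U \<zeta> * (1 - b / \<zeta>) * (1 / \<zeta>) ^ k) =
    circle_int (\<lambda>\<zeta>. U \<zeta> * (1 / \<zeta>) ^ k) - b * circle_int (\<lambda>\<zeta>. U \<zeta> * (1 / \<zeta>) ^ Suc k)"
proof -
  have "circle_int (\<lambda>\<zeta>. U \<zeta> * (1 - b / \<zeta>) * (1 / \<zeta>) ^ k) =
      circle_int (\<lambda>\<zeta>. U \<zeta> * (1 / \<zeta>) ^ k - b * (U \<zeta> * (1 / \<zeta>) ^ Suc k))"
    by (intro circle_int_cong) (simp add: algebra_simps diff_divide_distrib)
  also have "\<dots> = circle_int (\<lambda>\<zeta>. U \<zeta> * (1 / \<zeta>) ^ k) -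
      circle_int (\<lambda>\<zeta>. b * (U \<zeta> * (1 / \<zeta>) ^ Suc k))"
    by (intro circle_int_diff circle_weight_cmult circle_weight_mult_power_inverse U)
  finally show ?thesis by (simp only: circle_int_cmult)
qed

lemma circle_weight_factor:
  "circle_weight U \<Longrightarrow> circle_weight (\<lambda>\<zeta>. U \<zeta> * (1 - b / \<zeta>))"
  by (erule circle_weight_mult) (auto intro!: continuous_intros)

text \<open>The term \<open>b / \<zeta>\<close> raises the power by one and so costs one
  relation.\<close>

lemma ortho_factor:
  "circle_weight U \<Longrightarrow> ortho U (Suc m) \<Longrightarrow> ortho (\<lambda>\<zeta>. U \<zeta> * (1 - b / \<zeta>)) m"
  by (auto simp: ortho_def circle_int_factor simp del: power_Suc)

text \<open>By \<open>cauchy_shift\<close> for one power, a factor \<open>1 - b / \<zeta>\<close>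
  leaves the transform as \<open>1 - b / z\<close>. Each factor uses up one relation, so
  \<open>L\<close> relations suffice for the product. The induction varies \<open>u\<close> in order
  to absorb the factor just removed.\<close>

lemma cauchy_node_prod:
  assumes z: "z \<notin> sphere 0 1" "z \<noteq> 0"
  shows "circle_weight u \<Longrightarrow> ortho u L \<Longrightarrow>
    cauchy (\<lambda>\<zeta>. u \<zeta> * node_prod L \<beta> \<zeta>) z = node_prod L \<beta> z * cauchy u z"
proof (induction L arbitrary: u)
  case 0
  then show ?case by (simp add: node_prod_def)
next
  case (Suc L)
  let ?b = "\<beta> (Suc L)"
  let ?v = "\<lambda>\<zeta>. u \<zeta> * (1 - ?b / \<zeta>)"
  have S: "node_prod (Suc L) \<beta> x = node_prod L \<beta> x * (1 - ?b / x)" for x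
    by (simp add: node_prod_def)
  have sum: "cauchy u z - ?b * cauchy (\<lambda>\<zeta>. u \<zeta> * (1 / \<zeta>) ^ 1) z = cauchy ?v z"
  proof -
    have e: "x * (1 - ?b / \<zeta>) * y = x * y - ?b * ((x * (1 / \<zeta>) ^ 1) * y)" for x y \<zeta> :: complex
      by (simp add: algebra_simps)
    have "cauchy ?v z = circle_int (\<lambda>\<zeta>. u \<zeta> * (\<zeta> / (\<zeta> - z)) -
        ?b * ((u \<zeta> * (1 / \<zeta>) ^ 1) * (\<zeta> / (\<zeta> - z))))"
      unfolding cauchy_def by (intro circle_int_cong) (rule e)
    also have "\<dots> = cauchy u z - ?b * cauchy (\<lambda>\<zeta>. u \<zeta> * (1 / \<zeta>) ^ 1) z"
      unfolding cauchy_def circle_int_cmult[symmetric]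
      by (intro circle_int_diff circle_weight_cmult circle_weight_mult_cauchy_kernel
          circle_weight_mult_power_inverse Suc.prems z)
    finally show ?thesis by simp
  qed
  have shift: "cauchy (\<lambda>\<zeta>. u \<zeta> * (1 / \<zeta>) ^ 1) z = cauchy u z / z ^ 1"
    by (rule cauchy_shift[OF Suc.prems(1) z]) (rule ortho_mono[OF Suc.prems(2)], simp)
  have "cauchy (\<lambda>\<zeta>. u \<zeta> * node_prod (Suc L) \<beta> \<zeta>) z =
      cauchy (\<lambda>\<zeta>. ?v \<zeta> * node_prod L \<beta> \<zeta>) z"
    by (intro cauchy_cong) (simp add: S)
  also have "\<dots> = node_prod L \<beta> z * cauchy ?v z"
    by (intro Suc.IH circle_weight_factor ortho_factor Suc.prems)
  also have "cauchy ?v z = (1 - ?b / z) * cauchy u z"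
    unfolding sum[symmetric] shift by (simp add: left_diff_distrib)
  finally show ?case by (simp add: S)
qed

text \<open>The relations say that moment \<open>k\<close> of \<open>U\<close> is \<open>b\<close>
  times moment \<open>k + 1\<close>. Starting from moment 0, division by \<open>b\<close> makes all
  of them vanish up to \<open>m\<close>.\<close>

lemma ortho_from_factor:
  assumes U: "circle_weight U" and b: "b \<noteq> 0"
    and o: "ortho (\<lambda>\<zeta>. U \<zeta> * (1 - b / \<zeta>)) m" and z: "circle_int U = 0"
  shows "ortho U (Suc m)"
proof -
  have "k \<le> m \<Longrightarrow> circle_int (\<lambda>\<zeta>. U \<zeta> * (1 / \<zeta>) ^ k) = 0" for k
  proof (induction k)
    case (Suc k)
    then show ?case
      using orthoD[OF o, of k] b by (simp add: circle_int_factor[OF U] del: power_Suc)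
  qed (use z in simp)
  then show ?thesis by (simp add: ortho_def)
qed

text \<open>For distinct nodes \<open>b\<close> and \<open>c\<close>, removing one factor gives
  \<open>\<integral> U (1 - b/\<zeta>) = \<integral> U (1 - c/\<zeta>) = 0\<close>, hence \<open>\<integral> U/\<zeta> = 0\<close> and \<open>\<integral> U = 0\<close>; this replaces a partial
  fraction decomposition.\<close>

lemma ortho_divide_nodes:
  assumes u: "circle_weight u" and o: "ortho u m"
  shows "finite J \<Longrightarrow> (\<And>b. b \<in> J \<Longrightarrow> b \<noteq> 0 \<and> b \<notin> sphere 0 1 \<and> cauchy u b = 0) \<Longrightarrow>
    ortho (\<lambda>\<zeta>. u \<zeta> / (\<Prod>b\<in>J. 1 - b / \<zeta>)) (m + card J)"
proof (induction J rule: finite_psubset_induct)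
  case (psubset J)
  have nz: "1 - b / \<zeta> \<noteq> 0" if "b \<in> J" "\<zeta> \<in> sphere 0 1" for b \<zeta>
    using psubset.prems[OF that(1)] that by (auto simp: field_simps)
  let ?U = "\<lambda>\<zeta>. u \<zeta> / (\<Prod>b\<in>J. 1 - b / \<zeta>)"
  have U: "circle_weight ?U"
    unfolding divide_inverse using nz
    by (intro circle_weight_mult u continuous_intros) (auto simp: psubset.hyps(1) divide_inverse)
  have rem: "?U \<zeta> * (1 - b / \<zeta>) = u \<zeta> / (\<Prod>b\<in>J-{b}. 1 - b / \<zeta>)"
    if "b \<in> J" "\<zeta> \<in> sphere 0 1" for b \<zeta>
    using nz[OF that] that prod.remove[OF psubset.hyps(1) that(1), of "\<lambda>b. 1 - b / \<zeta>"] by simp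
  \<comment> \<open>Restoring the factor of \<open>b\<close> gives the quotient over
    \<open>J - {b}\<close>. Induction over proper subsets allows any node to be restored, which is
    needed for two nodes at once below.\<close>
  have IH: "ortho (\<lambda>\<zeta>. ?U \<zeta> * (1 - b / \<zeta>)) (m + card (J - {b}))" if "b \<in> J" for b
  proof -
    have "ortho (\<lambda>\<zeta>. u \<zeta> / (\<Prod>b\<in>J-{b}. 1 - b / \<zeta>)) (m + card (J - {b}))"
      using that psubset.prems by (intro psubset.IH) auto
    then show ?thesis using ortho_cong[OF rem[OF that]] by simp
  qed
  show ?case
  proof (cases "J = {}")
    case True
    then show ?thesis using o by simp
  next
    case False
    then obtain b where b: "b \<in> J" by auto
    have "circle_int ?U = 0"
    proof (cases "J = {b}")
      case True
      \<comment> \<open>For a single node, \<open>1 / (1 - b / \<zeta>)\<close> is the Cauchy kernel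
        at \<open>b\<close>, so moment 0 vanishes by hypothesis.\<close>
      have "circle_int ?U = cauchy u b"
        unfolding cauchy_def
      proof (rule circle_int_cong)
        fix \<zeta> :: complex assume \<zeta>: "\<zeta> \<in> sphere 0 1"
        then have "1 - b / \<zeta> = (\<zeta> - b) / \<zeta>" using sphere_nonzero by (simp add: diff_divide_distrib)
        then show "?U \<zeta> = u \<zeta> * (\<zeta> / (\<zeta> - b))" using True by simp
      qed
      then show ?thesis using psubset.prems[OF b] by simp
    next
      case False
      then obtain c where c: "c \<in> J" "c \<noteq> b" using b by auto
      \<comment> \<open>The second node ensures that, even for \<open>m = 0\<close>, both induction
        hypotheses contain the relation for the power 0.\<close>
      have "b \<in> J - {c}" "c \<in> J - {b}" using b c by auto
      then have "0 < m + card (J - {c})" "0 < m + card (J - {b})"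
        using psubset.hyps(1) by (metis add_gr_0 card_gt_0_iff empty_iff finite_Diff)+
      then have "circle_int (\<lambda>\<zeta>. ?U \<zeta> * (1 - d / \<zeta>) * (1 / \<zeta>) ^ 0) = 0" if "d = b \<or> d = c" for d
        using orthoD[OF IH[OF b]] orthoD[OF IH[OF c(1)]] that by blast
      then have "circle_int ?U = d * circle_int (\<lambda>\<zeta>. ?U \<zeta> * (1 / \<zeta>) ^ Suc 0)" if "d = b \<or> d = c" for d
        using circle_int_factor[OF U, of d 0] that by simp
      from this[of b] this[of c]
      have "b * circle_int (\<lambda>\<zeta>. ?U \<zeta> * (1 / \<zeta>) ^ Suc 0) =
          c * circle_int (\<lambda>\<zeta>. ?U \<zeta> * (1 / \<zeta>) ^ Suc 0)"
        "circle_int ?U = b * circle_int (\<lambda>\<zeta>. ?U \<zeta> * (1 / \<zeta>) ^ Suc 0)"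
        by argo+
      then show ?thesis using c(2) by auto
    qed
    then have "ortho ?U (Suc (m + card (J - {b})))"
      using psubset.prems[OF b] by (intro ortho_from_factor[OF U _ IH[OF b]]) auto
    then show ?thesis
      using card.remove[OF psubset.hyps(1) b] by simp
  qed
qed

section \<open>Bi-orthogonal systems\<close>

text \<open>One polynomial of each degree below \<open>m\<close> gives a basis, so leading terms can
  be removed successively. The degree premise is conditional in order to admit \<open>p = 0\<close>
  when \<open>m = 0\<close>.\<close>

lemma linear_functional_vanishes:
  fixes F :: "complex poly \<Rightarrow> complex"
  assumes add: "\<And>p q. F (p + q) = F p + F q" and smult: "\<And>c p. F (Polynomial.smult c p) = c * F p"
    and b: "\<And>k. k < m \<Longrightarrow> degree (b k) = k \<and> b k \<noteq> 0 \<and> F (b k) = 0"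
  shows "(p \<noteq> 0 \<Longrightarrow> degree p < m) \<Longrightarrow> F p = 0"
proof (induction "degree p" arbitrary: p rule: less_induct)
  case less
  show ?case
  proof (cases "p = 0")
    case True
    then show ?thesis using smult[of 0 p] by simp
  next
    case False
    let ?d = "degree p"
    let ?c = "lead_coeff p / lead_coeff (b ?d)"
    define q where "q = p - Polynomial.smult ?c (b ?d)"
    have bd: "degree (b ?d) = ?d" "b ?d \<noteq> 0" "F (b ?d) = 0"
      using b[OF less.prems[OF False]] by auto
    have lc: "coeff (b ?d) ?d \<noteq> 0"
      using bd by (metis leading_coeff_0_iff)
    have "degree q \<le> ?d"
      unfolding q_def by (rule degree_diff_le) (use bd in auto)
    moreover have "coeff q ?d = 0"
      using bd lc by (simp add: q_def)
    ultimately have q: "q = 0 \<or> degree q < ?d"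
      by (rule eq_zero_or_degree_less)
    have "F q = 0"
    proof (cases "q = 0")
      case True
      then show ?thesis using smult[of 0 q] by simp
    next
      case False
      then show ?thesis using q less.prems[OF \<open>p \<noteq> 0\<close>] by (intro less.hyps) auto
    qed
    then show ?thesis
      using add[of q "Polynomial.smult ?c (b ?d)"] smult bd by (simp add: q_def)
  qed
qed

lemma circle_weight_mult_poly_inverse:
  "circle_weight u \<Longrightarrow> circle_weight (\<lambda>\<zeta>. u \<zeta> * poly p (1 / \<zeta>))"
  by (erule circle_weight_mult) (auto intro!: continuous_intros)

lemma circle_int_poly_linear:
  assumes u: "circle_weight u"
  shows "circle_int (\<lambda>\<zeta>. u \<zeta> * poly (p + q) \<zeta>) =
      circle_int (\<lambda>\<zeta>. u \<zeta> * poly p \<zeta>) + circle_int (\<lambda>\<zeta>. u \<zeta> * poly q \<zeta>)"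
    and "circle_int (\<lambda>\<zeta>. u \<zeta> * poly (Polynomial.smult c p) \<zeta>) = c * circle_int (\<lambda>\<zeta>. u \<zeta> * poly p \<zeta>)"
    and "circle_int (\<lambda>\<zeta>. u \<zeta> * poly (p + q) (1 / \<zeta>)) =
      circle_int (\<lambda>\<zeta>. u \<zeta> * poly p (1 / \<zeta>)) + circle_int (\<lambda>\<zeta>. u \<zeta> * poly q (1 / \<zeta>))"
    and "circle_int (\<lambda>\<zeta>. u \<zeta> * poly (Polynomial.smult c p) (1 / \<zeta>)) =
      c * circle_int (\<lambda>\<zeta>. u \<zeta> * poly p (1 / \<zeta>))"
  using circle_int_add[OF circle_weight_mult_poly[OF u] circle_weight_mult_poly[OF u], of p q]
    circle_int_add[OF circle_weight_mult_poly_inverse[OF u] circle_weight_mult_poly_inverse[OF u], of p q]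
    circle_int_cmult[of c "\<lambda>\<zeta>. u \<zeta> * poly p \<zeta>"] circle_int_cmult[of c "\<lambda>\<zeta>. u \<zeta> * poly p (1 / \<zeta>)"]
  by (simp_all add: ring_distribs mult.left_commute)

lemma circle_int_eq_0_if_ortho:
  assumes u: "circle_weight u" and o: "ortho u m" and p: "p \<noteq> 0 \<Longrightarrow> degree p < m"
  shows "circle_int (\<lambda>\<zeta>. u \<zeta> * poly p (1 / \<zeta>)) = 0"
  by (rule linear_functional_vanishes[where m = m and b = "\<lambda>k. monom 1 k"];
      (rule circle_int_poly_linear[OF u])?)
    (use o p in \<open>auto simp: degree_monom_eq poly_monom ortho_def\<close>)

context
  fixes w \<phi> \<phi>b
  assumes w: "circle_weight w" and sys: "biorthogonal_system w \<phi> \<phi>b"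
begin

lemma biorthogonal:
  "circle_int (\<lambda>\<zeta>. w \<zeta> * poly (\<phi> m) \<zeta> * poly (\<phi>b n) (1 / \<zeta>)) = (if m = n then 1 else 0)"
  using sys by (simp add: biorthogonal_system_def)

lemma biorthogonal_commute:
  "circle_int (\<lambda>\<zeta>. w \<zeta> * poly (\<phi>b n) (1 / \<zeta>) * poly (\<phi> m) \<zeta>) = (if m = n then 1 else 0)"
  unfolding biorthogonal[symmetric]
  by (rule circle_int_cong) (simp only: mult.assoc mult.commute[of "poly (\<phi>b n) _"])

lemma biorthogonal_degree:
  "degree (\<phi> m) = m" "degree (\<phi>b m) = m" "coeff (\<phi>b m) m = coeff (\<phi> m) m"
  using sys unfolding biorthogonal_system_def by metis+

lemma biorthogonal_nonzero: "\<phi> m \<noteq> 0" "\<phi>b m \<noteq> 0"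
proof -
  have z: "circle_int (\<lambda>\<zeta>. 0) = 0"
    using circle_int_cmult[of 0 "\<lambda>_. 0"] by simp
  show "\<phi> m \<noteq> 0" "\<phi>b m \<noteq> 0"
    using biorthogonal[of m m] z by auto
qed

lemma biorthogonal_lead: "coeff (\<phi> m) m \<noteq> 0"
  using biorthogonal_nonzero biorthogonal_degree by (metis leading_coeff_0_iff)

lemma biorthogonal_lower_right:
  assumes "q \<noteq> 0 \<Longrightarrow> degree q < m"
  shows "circle_int (\<lambda>\<zeta>. w \<zeta> * poly (\<phi> m) \<zeta> * poly q (1 / \<zeta>)) = 0"
  by (rule linear_functional_vanishes[where m = m and b = \<phi>b];
      (rule circle_int_poly_linear[OF circle_weight_mult_poly[OF w]])?)
    (use assms biorthogonal_degree biorthogonal_nonzero in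
      \<open>simp_all add: biorthogonal\<close>)

lemma biorthogonal_lower_left:
  assumes "q \<noteq> 0 \<Longrightarrow> degree q < m"
  shows "circle_int (\<lambda>\<zeta>. w \<zeta> * poly (\<phi>b m) (1 / \<zeta>) * poly q \<zeta>) = 0"
  by (rule linear_functional_vanishes[where m = m and b = \<phi>];
      (rule circle_int_poly_linear[OF circle_weight_mult_poly_inverse[OF w]])?)
    (use assms biorthogonal_degree biorthogonal_nonzero in
      \<open>simp_all add: biorthogonal_commute\<close>)

lemma ortho_biorthogonal: "ortho (\<lambda>\<zeta>. w \<zeta> * poly (\<phi> m) \<zeta>) m"
  unfolding ortho_def
proof (intro allI impI)
  fix k assume "k < m"
  then show "circle_int (\<lambda>\<zeta>. w \<zeta> * poly (\<phi> m) \<zeta> * (1 / \<zeta>) ^ k) = 0"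
    using biorthogonal_lower_right[of "monom 1 k" m] by (simp add: poly_monom degree_monom_eq)
qed

lemma poly_reciprocal_on_circle:
  "\<zeta> \<noteq> 0 \<Longrightarrow> poly (reciprocal \<phi>b m) \<zeta> = \<zeta> ^ m * poly (\<phi>b m) (1 / \<zeta>)"
  by (rule poly_reciprocal[OF sys])

text \<open>On the circle the powers combine to \<open>\<zeta> ^ (m - Suc k)\<close> times
  \<open>poly (\<phi>b m) (1 / \<zeta>)\<close>. The exponent lies between 0 and
  \<open>m - 1\<close>, so biorthogonality applies; the division of the weight by \<zeta> produces
  exactly this range.\<close>

lemma ortho_reciprocal: "ortho (\<lambda>\<zeta>. w \<zeta> / \<zeta> * poly (reciprocal \<phi>b m) \<zeta>) m"
  unfolding ortho_def
proof (intro allI impI)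
  fix k assume k: "k < m"
  have "circle_int (\<lambda>\<zeta>. w \<zeta> / \<zeta> * poly (reciprocal \<phi>b m) \<zeta> * (1 / \<zeta>) ^ k) =
      circle_int (\<lambda>\<zeta>. w \<zeta> * poly (\<phi>b m) (1 / \<zeta>) * poly (monom 1 (m - Suc k)) \<zeta>)"
  proof (rule circle_int_cong)
    fix \<zeta> :: complex assume "\<zeta> \<in> sphere 0 1"
    then have z: "\<zeta> \<noteq> 0" by auto
    have "\<zeta> ^ m = \<zeta> ^ (m - Suc k) * \<zeta> ^ k * \<zeta>"
      using k by (simp flip: power_add power_Suc2)
    then show "w \<zeta> / \<zeta> * poly (reciprocal \<phi>b m) \<zeta> * (1 / \<zeta>) ^ k =
        w \<zeta> * poly (\<phi>b m) (1 / \<zeta>) * poly (monom 1 (m - Suc k)) \<zeta>"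
      using z by (simp add: poly_reciprocal_on_circle poly_monom power_one_over)
  qed
  also have "\<dots> = 0"
    using k by (intro biorthogonal_lower_left) (simp add: degree_monom_eq)
  finally show "circle_int (\<lambda>\<zeta>. w \<zeta> / \<zeta> * poly (reciprocal \<phi>b m) \<zeta> * (1 / \<zeta>) ^ k) = 0" .
qed

text \<open>Pairing \<open>q\<close> with \<open>\<phi>b\<close> at the index
  \<open>degree q\<close> gives 0 by orthogonality, but by biorthogonality it gives the leading
  coefficient of \<open>q\<close> up to a nonzero factor.\<close>

lemma eq_0_if_ortho:
  assumes "ortho (\<lambda>\<zeta>. w \<zeta> * poly q \<zeta>) n" "q \<noteq> 0 \<Longrightarrow> degree q < n"
  shows "q = 0"
proof (rule ccontr)
  assume q: "q \<noteq> 0"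
  let ?d = "degree q"
  let ?c = "lead_coeff q / coeff (\<phi> ?d) ?d"
  define r where "r = q - Polynomial.smult ?c (\<phi> ?d)"
  have "degree r \<le> ?d"
    unfolding r_def by (rule degree_diff_le) (use biorthogonal_degree in auto)
  moreover have "coeff r ?d = 0"
    using biorthogonal_lead by (simp add: r_def)
  ultimately have r: "r = 0 \<or> degree r < ?d"
    by (rule eq_zero_or_degree_less)
  have wb: "circle_weight (\<lambda>\<zeta>. w \<zeta> * poly (\<phi>b ?d) (1 / \<zeta>))"
    by (intro circle_weight_mult_poly_inverse w)
  have "circle_int (\<lambda>\<zeta>. w \<zeta> * poly q \<zeta> * poly (\<phi>b ?d) (1 / \<zeta>)) = 0"
    using assms(2)[OF q]
    by (intro circle_int_eq_0_if_ortho[OF circle_weight_mult_poly[OF w] assms(1)])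
      (simp add: biorthogonal_degree)
  moreover have "circle_int (\<lambda>\<zeta>. w \<zeta> * poly q \<zeta> * poly (\<phi>b ?d) (1 / \<zeta>)) =
      circle_int (\<lambda>\<zeta>. w \<zeta> * poly (\<phi>b ?d) (1 / \<zeta>) * poly (r + Polynomial.smult ?c (\<phi> ?d)) \<zeta>)"
    by (simp add: r_def mult.assoc mult.commute[of "poly q _"])
  moreover have "circle_int (\<lambda>\<zeta>. w \<zeta> * poly (\<phi>b ?d) (1 / \<zeta>) * poly r \<zeta>) = 0"
    using r by (intro biorthogonal_lower_left) auto
  ultimately have "?c = 0"
    unfolding circle_int_poly_linear(1,2)[OF wb] biorthogonal_commute by simp
  then show False
    using q biorthogonal_lead by simp
qed

text \<open>Subtracting the multiple of \<open>\<phi> n\<close> with the same coefficient at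
  \<open>n\<close> leaves a polynomial of lower degree with the same relations, hence 0.\<close>

lemma multiple_if_ortho:
  assumes o: "ortho (\<lambda>\<zeta>. w \<zeta> * poly q \<zeta>) n" and q: "degree q \<le> n"
  shows "\<exists>c. q = Polynomial.smult c (\<phi> n)"
proof -
  let ?c = "coeff q n / coeff (\<phi> n) n"
  define r where "r = q - Polynomial.smult ?c (\<phi> n)"
  have "degree r \<le> n"
    unfolding r_def by (rule degree_diff_le) (use biorthogonal_degree q in auto)
  moreover have "coeff r n = 0"
    using biorthogonal_lead by (simp add: r_def)
  ultimately have r: "r = 0 \<or> degree r < n"
    by (rule eq_zero_or_degree_less)
  have "ortho (\<lambda>\<zeta>. w \<zeta> * poly r \<zeta>) n"
    unfolding ortho_def
  proof (intro allI impI)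
    fix k assume k: "k < n"
    have w': "circle_weight (\<lambda>\<zeta>. w \<zeta> * (1 / \<zeta>) ^ k)"
      by (intro circle_weight_mult_power_inverse w)
    have "circle_int (\<lambda>\<zeta>. w \<zeta> * (1 / \<zeta>) ^ k * poly (r + Polynomial.smult ?c (\<phi> n)) \<zeta>) = 0"
      using orthoD[OF o k] by (simp add: r_def mult_ac)
    then show "circle_int (\<lambda>\<zeta>. w \<zeta> * poly r \<zeta> * (1 / \<zeta>) ^ k) = 0"
      using orthoD[OF ortho_biorthogonal k]
      unfolding circle_int_poly_linear[OF w'] by (simp add: mult_ac)
  qed
  then have "r = 0"
    using r by (intro eq_0_if_ortho) auto
  then show ?thesis by (auto simp: r_def)
qed

text \<open>Here constant terms are matched: that of the reciprocal polynomial is the leading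
  coefficient of \<open>\<phi>b n\<close>, hence nonzero. The difference has a factor \<zeta> that
  cancels the one dividing the weight, and the cofactor \<open>s\<close> has degree below
  \<open>n\<close>, so \<open>eq_0_if_ortho\<close> applies to \<open>s\<close> and \<open>w\<close>
  itself.\<close>

lemma multiple_reciprocal_if_ortho:
  assumes o: "ortho (\<lambda>\<zeta>. w \<zeta> / \<zeta> * poly q \<zeta>) n" and q: "degree q \<le> n"
  shows "\<exists>c. q = Polynomial.smult c (reciprocal \<phi>b n)"
proof -
  let ?p = "reciprocal \<phi>b n"
  have p0: "coeff ?p 0 \<noteq> 0"
    using biorthogonal_lead biorthogonal_degree biorthogonal_nonzero by (simp add: reciprocal_def)
  let ?c = "coeff q 0 / coeff ?p 0"
  define r where "r = q - Polynomial.smult ?c ?p"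
  have "degree r \<le> n"
    unfolding r_def reciprocal_def
    by (intro degree_diff_le) (use q degree_reflect_poly_le[of "\<phi>b n"] biorthogonal_degree in auto)
  moreover have "coeff r 0 = 0"
    using p0 by (simp add: r_def)
  then obtain s where s: "r = pCons 0 s"
    by (cases r) auto
  ultimately have ds: "s \<noteq> 0 \<Longrightarrow> degree s < n"
    by simp
  have "ortho (\<lambda>\<zeta>. w \<zeta> * poly s \<zeta>) n"
    unfolding ortho_def
  proof (intro allI impI)
    fix k assume k: "k < n"
    have w': "circle_weight (\<lambda>\<zeta>. w \<zeta> / \<zeta> * (1 / \<zeta>) ^ k)"
      using circle_weight_mult_power_inverse[OF w, of "Suc k"] by simp
    have "circle_int (\<lambda>\<zeta>. w \<zeta> / \<zeta> * (1 / \<zeta>) ^ k * poly (r + Polynomial.smult ?c ?p) \<zeta>) = 0"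
      using orthoD[OF o k] by (simp add: r_def mult_ac)
    then have "circle_int (\<lambda>\<zeta>. w \<zeta> / \<zeta> * (1 / \<zeta>) ^ k * poly r \<zeta>) = 0"
      using orthoD[OF ortho_reciprocal k]
      unfolding circle_int_poly_linear[OF w'] by (simp add: mult_ac)
    moreover have "circle_int (\<lambda>\<zeta>. w \<zeta> / \<zeta> * (1 / \<zeta>) ^ k * poly r \<zeta>) =
        circle_int (\<lambda>\<zeta>. w \<zeta> * poly s \<zeta> * (1 / \<zeta>) ^ k)"
      by (intro circle_int_cong) (auto simp: s)
    ultimately show "circle_int (\<lambda>\<zeta>. w \<zeta> * poly s \<zeta> * (1 / \<zeta>) ^ k) = 0"
      by simp
  qed
  then have "s = 0"
    using ds by (intro eq_0_if_ortho) auto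
  then show ?thesis using s by (auto simp: r_def)
qed

section \<open>Associated functions as Cauchy transforms\<close>

text \<open>The kernel equals \<open>2 * (\<zeta> / (\<zeta> - z)) - 1\<close>. The moment coming
  from \<open>- 1\<close> vanishes for \<open>m > 0\<close> and is compensated for
  \<open>m = 0\<close> by the extra term in the definition.\<close>

lemma assoc_eq_cauchy:
  assumes z: "z \<notin> sphere 0 1"
  shows "assoc w \<phi> m z = 2 * cauchy (\<lambda>\<zeta>. w \<zeta> * poly (\<phi> m) \<zeta>) z"
proof -
  let ?u = "\<lambda>\<zeta>. w \<zeta> * poly (\<phi> m) \<zeta>"
  have u: "circle_weight ?u" by (intro circle_weight_mult_poly w)
  have k: "(\<zeta> + z) / (\<zeta> - z) = 2 * (\<zeta> / (\<zeta> - z)) - 1" if "\<zeta> \<in> sphere 0 1" for \<zeta>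
  proof -
    have "\<zeta> - z \<noteq> 0" using z that by auto
    then show ?thesis by (simp add: divide_simps)
  qed
  have e: "(2 * c - 1) * x * y = 2 * (x * y * c) - x * y" for c x y :: complex
    by (simp add: algebra_simps)
  have "circle_int (\<lambda>\<zeta>. (\<zeta> + z) / (\<zeta> - z) * w \<zeta> * poly (\<phi> m) \<zeta>) =
      circle_int (\<lambda>\<zeta>. 2 * (?u \<zeta> * (\<zeta> / (\<zeta> - z))) - ?u \<zeta>)"
    by (rule circle_int_cong) (simp only: k e)
  also have "\<dots> = 2 * cauchy ?u z - circle_int ?u"
    unfolding cauchy_def circle_int_cmult[symmetric]
    by (intro circle_int_diff circle_weight_cmult circle_weight_mult_cauchy_kernel u z)
  finally have *: "circle_int (\<lambda>\<zeta>. (\<zeta> + z) / (\<zeta> - z) * w \<zeta> * poly (\<phi> m) \<zeta>) =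
      2 * cauchy ?u z - circle_int ?u" .
  show ?thesis
  proof (cases "m = 0")
    case True
    define c where "c = coeff (\<phi> 0) 0"
    have c: "poly (\<phi> m) \<zeta> = c" for \<zeta>
      using True biorthogonal_degree(1)[of 0] by (auto simp: c_def elim: degree_eq_zeroE)
    have "c * caratheodory w z = circle_int (\<lambda>\<zeta>. (\<zeta> + z) / (\<zeta> - z) * w \<zeta> * poly (\<phi> m) \<zeta>)"
      unfolding caratheodory_def circle_int_cmult[symmetric] c by (simp only: mult_ac)
    moreover have "c * fourier_coeff w 0 = circle_int ?u"
      unfolding fourier_coeff_def circle_int_cmult[symmetric] c by (simp add: mult_ac)
    ultimately show ?thesis
      using True * by (simp add: assoc_def biorthogonal_degree ring_distribs c_def)
  next
    case False
    then show ?thesis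
      using * orthoD[OF ortho_biorthogonal[of m], of 0] by (simp add: assoc_def)
  qed
qed

text \<open>The kernel is now expanded around 1, with remainder
  \<open>2 * z / (\<zeta> - z)\<close>. Passing from \<open>\<phi>b m\<close> to the reciprocal
  polynomial costs \<open>m\<close> powers of \<open>1 / \<zeta>\<close>; by
  \<open>cauchy_shift\<close> these become \<open>1 / z ^ m\<close> and cancel the prefactor
  \<open>z ^ m\<close>.\<close>

lemma assoc_star_eq_cauchy:
  assumes z: "z \<notin> sphere 0 1" "z \<noteq> 0"
  shows "assoc_star w \<phi>b m z = - 2 * z * cauchy (\<lambda>\<zeta>. w \<zeta> / \<zeta> * poly (reciprocal \<phi>b m) \<zeta>) z"
proof -
  let ?u = "\<lambda>\<zeta>. w \<zeta> * poly (\<phi>b m) (1 / \<zeta>)"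
  let ?v = "\<lambda>\<zeta>. w \<zeta> / \<zeta> * poly (reciprocal \<phi>b m) \<zeta>"
  have u: "circle_weight ?u" by (intro circle_weight_mult_poly_inverse w)
  have "circle_weight (\<lambda>\<zeta>. w \<zeta> / \<zeta>)"
    using circle_weight_mult_power_inverse[OF w, of 1] by simp
  then have v: "circle_weight ?v"
    by (rule circle_weight_mult_poly)
  have u': "circle_weight (\<lambda>\<zeta>. ?u \<zeta> / \<zeta>)"
    using circle_weight_mult_power_inverse[OF u, of 1] by simp
  have k: "(\<zeta> + z) / (\<zeta> - z) = 1 + 2 * z * ((1 / \<zeta>) * (\<zeta> / (\<zeta> - z)))" if "\<zeta> \<in> sphere 0 1" for \<zeta>
  proof -
    have "\<zeta> - z \<noteq> 0" "\<zeta> \<noteq> 0" using z that by auto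
    then show ?thesis by (simp add: divide_simps)
  qed
  have e: "(1 + 2 * z * ((1 / \<zeta>) * c)) * x * y = x * y + 2 * z * ((x * y / \<zeta>) * c)"
    for c x y \<zeta> :: complex
    by (simp add: algebra_simps)
  have "circle_int (\<lambda>\<zeta>. (\<zeta> + z) / (\<zeta> - z) * w \<zeta> * poly (\<phi>b m) (1 / \<zeta>)) =
      circle_int (\<lambda>\<zeta>. ?u \<zeta> + 2 * z * ((?u \<zeta> / \<zeta>) * (\<zeta> / (\<zeta> - z))))"
  proof (rule circle_int_cong)
    fix \<zeta> :: complex assume *: "\<zeta> \<in> sphere 0 1"
    show "(\<zeta> + z) / (\<zeta> - z) * w \<zeta> * poly (\<phi>b m) (1 / \<zeta>) =
        ?u \<zeta> + 2 * z * ((?u \<zeta> / \<zeta>) * (\<zeta> / (\<zeta> - z)))"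
      unfolding k[OF *] by (rule e)
  qed
  also have "\<dots> = circle_int ?u + 2 * z * cauchy (\<lambda>\<zeta>. ?u \<zeta> / \<zeta>) z"
    unfolding cauchy_def circle_int_cmult[symmetric]
    by (intro circle_int_add circle_weight_cmult circle_weight_mult_cauchy_kernel u u' z)
  also have "cauchy (\<lambda>\<zeta>. ?u \<zeta> / \<zeta>) z = cauchy (\<lambda>\<zeta>. ?v \<zeta> * (1 / \<zeta>) ^ m) z"
    by (rule cauchy_cong, frule sphere_nonzero)
      (simp add: poly_reciprocal_on_circle power_one_over)
  also have "\<dots> = cauchy ?v z / z ^ m"
    by (rule cauchy_shift[OF v z ortho_reciprocal])
  finally have *: "circle_int (\<lambda>\<zeta>. (\<zeta> + z) / (\<zeta> - z) * w \<zeta> * poly (\<phi>b m) (1 / \<zeta>)) =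
      circle_int ?u + 2 * z * (cauchy ?v z / z ^ m)" .
  show ?thesis
  proof (cases "m = 0")
    case True
    define c where "c = coeff (\<phi>b 0) 0"
    have c: "poly (\<phi>b m) \<zeta> = c" for \<zeta>
      using True biorthogonal_degree(2)[of 0] by (auto simp: c_def elim: degree_eq_zeroE)
    have "c * caratheodory w z =
        circle_int (\<lambda>\<zeta>. (\<zeta> + z) / (\<zeta> - z) * w \<zeta> * poly (\<phi>b m) (1 / \<zeta>))"
      unfolding caratheodory_def circle_int_cmult[symmetric] c by (simp only: mult_ac)
    moreover have "c * fourier_coeff w 0 = circle_int ?u"
      unfolding fourier_coeff_def circle_int_cmult[symmetric] c by (simp add: mult_ac)
    ultimately show ?thesis
      using True * by (simp add: assoc_star_def biorthogonal_degree right_diff_distrib c_def)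
  next
    case False
    then have "circle_int ?u = 0"
      using biorthogonal_lower_left[of 1 m] by simp
    then show ?thesis
      using * False z by (simp add: assoc_star_def)
  qed
qed

end

section \<open>Combinations annihilated by the lower rows\<close>

lemma det_mat_of_rows_Cons:
  fixes rs :: "complex Matrix.vec list"
  assumes len: "length rs = N"
  shows "\<exists>c. \<forall>r. Determinant.det (mat_of_rows (Suc N) (r # rs)) =
    (\<Sum>i<Suc N. c i * vec_index r i)"
proof -
  let ?A = "\<lambda>r. mat_of_rows (Suc N) (r # rs)"
  have A: "?A r \<in> carrier_mat (Suc N) (Suc N)" for r
    using len mat_of_rows_carrier(1)[of "Suc N" "r # rs"] by simp
  \<comment> \<open>The minors do not see the first row, so the dummy row \<open>0\<^sub>v 0\<close>
    may replace it; the cofactors then visibly do not depend on \<open>r\<close>.\<close>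
  have minor: "mat_delete (?A r) 0 i = mat_delete (?A (0\<^sub>v 0)) 0 i" for r i
    using len by (intro eq_matI) (auto simp: mat_delete_def mat_of_rows_def)
  have entry: "?A r $$ (0, i) = vec_index r i" if "i < Suc N" for r i
    using that len by (simp add: mat_of_rows_def)
  have "Determinant.det (?A r) =
      (\<Sum>i<Suc N. cofactor (?A (0\<^sub>v 0)) 0 i * vec_index r i)" for r
    unfolding laplace_expansion_row[OF A[of r], of 0, OF zero_less_Suc]
    unfolding cofactor_def minor[of r] by (intro sum.cong refl) (simp add: entry mult.commute)
  then show ?thesis by blast
qed

text \<open>Combined with the expansion above, this says that the cofactors of the first row
  annihilate every lower row.\<close>

lemma det_mat_of_rows_repeated:
  fixes rs :: "complex Matrix.vec list"
  assumes len: "length rs = N" and rs: "set rs \<subseteq> carrier_vec (Suc N)" and r: "r \<in> set rs"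
  shows "Determinant.det (mat_of_rows (Suc N) (r # rs)) = 0"
proof -
  obtain j where j: "j < N" "r = rs ! j"
    using r len by (metis in_set_conv_nth)
  show ?thesis
  proof (rule det_identical_rows[where i = 0 and j = "Suc j"])
    show "mat_of_rows (Suc N) (r # rs) \<in> carrier_mat (Suc N) (Suc N)"
      using len mat_of_rows_carrier(1)[of "Suc N" "r # rs"] by simp
    show "row (mat_of_rows (Suc N) (r # rs)) 0 = row (mat_of_rows (Suc N) (r # rs)) (Suc j)"
      using j len rs r by (subst (1 2) mat_of_rows_row) auto
  qed (use j in auto)
qed

lemma det_mat_of_rows_kernel:
  fixes rs :: "complex Matrix.vec list"
  assumes len: "length rs = N" and 0: "Determinant.det (mat_of_rows N rs) = 0"
  shows "\<exists>c. (\<exists>i<N. c i \<noteq> 0) \<and> (\<forall>r\<in>set rs. (\<Sum>i<N. c i * vec_index r i) = 0)"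
proof -
  let ?A = "mat_of_rows N rs"
  have A: "?A \<in> carrier_mat N N"
    using len mat_of_rows_carrier(1)[of N rs] by simp
  obtain v where v: "v \<in> carrier_vec N" "v \<noteq> 0\<^sub>v N" "?A *\<^sub>v v = 0\<^sub>v N"
    using 0 det_0_iff_vec_prod_zero_field[OF A] by auto
  have "\<exists>i<N. vec_index v i \<noteq> 0"
  proof (rule ccontr)
    assume "\<not> ?thesis"
    then have "v = 0\<^sub>v N" using v(1) by (intro eq_vecI) auto
    then show False using v(2) by simp
  qed
  moreover have "(\<Sum>i<N. vec_index v i * vec_index r i) = 0" if r: "r \<in> set rs" for r
  proof -
    obtain j where j: "j < N" "r = rs ! j"
      using r len by (metis in_set_conv_nth)
    have "vec_index (?A *\<^sub>v v) j = 0" using v(3) j by simp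
    moreover have "vec_index (?A *\<^sub>v v) j = (\<Sum>i<N. vec_index v i * vec_index r i)"
      using j len v(1)
      by (simp add: mat_of_rows_def mult_mat_vec_def scalar_prod_def row_def atLeast0LessThan mult.commute)
    ultimately show ?thesis by simp
  qed
  ultimately show ?thesis by blast
qed

section \<open>Products over the nodes\<close>

lemma linear_factors_dvd:
  fixes G :: "complex poly"
  assumes "finite I" "inj_on \<alpha> I" "\<And>j. j \<in> I \<Longrightarrow> poly G (\<alpha> j) = 0"
  shows "(\<Prod>j\<in>I. [:- \<alpha> j, 1:]) dvd G"
  using assms
proof (induction I)
  case (insert i I)
  then obtain R where R: "G = (\<Prod>j\<in>I. [:- \<alpha> j, 1:]) * R" by (auto elim: dvdE)
  have "poly (\<Prod>j\<in>I. [:- \<alpha> j, 1:]) (\<alpha> i) \<noteq> 0"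
    using insert.hyps insert.prems(1) by (auto simp: poly_prod inj_on_def)
  then have "poly R (\<alpha> i) = 0"
    using insert.prems(2)[of i] R by simp
  then have "[:- \<alpha> i, 1:] dvd R" by (simp add: poly_eq_0_iff_dvd)
  then show ?case
    unfolding R prod.insert[OF insert.hyps] mult.commute[of "\<Prod>j\<in>I. [:- \<alpha> j, 1:]" R]
    by (rule mult_dvd_mono[OF _ dvd_refl])
qed simp

lemma degree_prod_linear:
  "finite I \<Longrightarrow> degree (\<Prod>j\<in>I. [:- \<alpha> j :: complex, 1:]) = card I"
  by (subst degree_prod_eq_sum_degree) auto

lemma node_prod_eq:
  "z \<noteq> 0 \<Longrightarrow> z ^ K * node_prod K \<alpha> z = (\<Prod>j=1..K. z - \<alpha> j)"
  by (induction K) (simp_all add: node_prod_def field_simps)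

lemma continuous_on_node_prod: "continuous_on (sphere 0 1) (node_prod K \<alpha>)"
  unfolding node_prod_def by (intro continuous_intros) auto

lemma node_prod_nonzero:
  assumes "z \<noteq> 0" "\<And>j. j \<in> {1..L} \<Longrightarrow> \<beta> j \<noteq> z"
  shows "node_prod L \<beta> z \<noteq> 0"
  using assms by (simp add: node_prod_def)

lemma node_prod_nonzero_on_circle:
  assumes "\<And>j. j \<in> {1..L} \<Longrightarrow> \<beta> j \<notin> sphere 0 1" "\<zeta> \<in> sphere 0 1"
  shows "node_prod L \<beta> \<zeta> \<noteq> 0"
  using assms by (intro node_prod_nonzero) (auto intro: sphere_nonzero)

lemma circle_weight_modified_weight:
  assumes w: "circle_weight w" and beta: "\<And>j. j \<in> {1..L} \<Longrightarrow> \<beta> j \<notin> sphere 0 1"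
  shows "circle_weight (modified_weight K L \<alpha> \<beta> w)"
proof -
  have "circle_weight (\<lambda>\<zeta>. w \<zeta> * (node_prod K \<alpha> \<zeta> / node_prod L \<beta> \<zeta>))"
    by (intro circle_weight_mult w continuous_on_divide continuous_on_node_prod ballI
        node_prod_nonzero_on_circle beta)
  then show ?thesis
    by (rule circle_weight_cong) (simp add: modified_weight_def)
qed

text \<open>Truncated subtraction merges the two cases of the row: \<open>i - L\<close> is 0 for
  \<open>i \<le> L\<close>.\<close>

lemma det_row_index:
  "i < K + L + 1 \<Longrightarrow> vec_index (det_row K L n a z) i = (1 / z) ^ (i - L) * a (n - L + i) z"
  unfolding det_row_def power_int_minus power_int_of_nat power_one_over inverse_eq_divide by simp

section \<open>The common setting of the unstarred and starred formulas\<close>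

text \<open>The instances are \<open>w\<close>, \<open>\<phi>\<close>, \<open>\<Phi> n\<close> and
  \<open>w\<close> divided by \<zeta> with the two reciprocal families. Both share these degree,
  orthogonality and uniqueness properties.\<close>

locale darboux =
  fixes u :: "complex \<Rightarrow> complex" and K L n :: nat and \<alpha> \<beta> :: "nat \<Rightarrow> complex"
    and p :: "nat \<Rightarrow> complex poly" and P :: "complex poly"
  assumes u: "circle_weight u"
    and alpha: "inj_on \<alpha> {1..K}" "\<And>j. j \<in> {1..K} \<Longrightarrow> \<alpha> j \<noteq> 0"
    and beta: "inj_on \<beta> {1..L}" "\<And>j. j \<in> {1..L} \<Longrightarrow> \<beta> j \<noteq> 0 \<and> \<beta> j \<notin> sphere 0 1"
    and n: "L \<le> n"
    and degree_p: "\<And>m. degree (p m) = m"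
    and p_0: "\<And>m. poly (p m) 0 \<noteq> 0"
    and ortho_p: "\<And>m. ortho (\<lambda>\<zeta>. u \<zeta> * poly (p m) \<zeta>) m"
    and P: "P \<noteq> 0" "degree P \<le> n"
    and ortho_P: "ortho (\<lambda>\<zeta>. modified_weight K L \<alpha> \<beta> u \<zeta> * poly P \<zeta>) n"
    and unique: "\<And>R. ortho (\<lambda>\<zeta>. modified_weight K L \<alpha> \<beta> u \<zeta> * poly R \<zeta>) n \<Longrightarrow>
      degree R \<le> n \<Longrightarrow> \<exists>c. R = Polynomial.smult c P"
begin

abbreviation "N \<equiv> K + L + 1"

abbreviation "wh \<equiv> modified_weight K L \<alpha> \<beta> u"

definition comb :: "(nat \<Rightarrow> complex) \<Rightarrow> complex \<Rightarrow> complex" where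
  "comb c z = (\<Sum>i<N. c i * ((1 / z) ^ (i - L) * poly (p (n - L + i)) z))"

text \<open>This is \<open>z ^ K * comb c z\<close> as a polynomial: for \<open>i < N\<close> the
  exponent \<open>K - (i - L)\<close> is not truncated.\<close>

definition comb_poly :: "(nat \<Rightarrow> complex) \<Rightarrow> complex poly" where
  "comb_poly c = (\<Sum>i<N. Polynomial.smult (c i) (monom 1 (K - (i - L)) * p (n - L + i)))"

lemma poly_comb_poly: "z \<noteq> 0 \<Longrightarrow> poly (comb_poly c) z = z ^ K * comb c z"
  unfolding comb_poly_def comb_def sum_distrib_left poly_sum
  by (intro sum.cong refl) (simp add: poly_monom power_diff power_one_over)

lemma degree_comb_poly: "degree (comb_poly c) \<le> K + n"
  unfolding comb_poly_def
proof (rule degree_sum_le)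
  fix i assume "i \<in> {..<N}"
  \<comment> \<open>For \<open>i > L\<close> the shrinking monomial exactly offsets the growing
    degree of \<open>p\<close>, and the sum is \<open>K + n\<close>; for \<open>i \<le> L\<close> it
    is at most that.\<close>
  then have "K - (i - L) + (n - L + i) \<le> K + n" using n by auto
  then show "degree (Polynomial.smult (c i) (monom 1 (K - (i - L)) * p (n - L + i))) \<le> K + n"
    using degree_mult_le[of "monom 1 (K - (i - L))" "p (n - L + i)"]
      degree_smult_le[of "c i" "monom 1 (K - (i - L)) * p (n - L + i)"]
    by (simp add: degree_monom_eq degree_p)
qed simp

text \<open>Let \<open>m\<close> be the last index with a nonzero coefficient. Only its term contributes to the lowest
  power of \<open>z\<close> if \<open>m > L\<close>, and to the highest power if \<open>m \<le> L\<close>.\<close>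

lemma comb_eq_0D:
  assumes 0: "\<And>z. z \<noteq> 0 \<Longrightarrow> comb c z = 0" and i: "i < N"
  shows "c i = 0"
proof (rule ccontr)
  assume ci: "c i \<noteq> 0"
  \<comment> \<open>The combination is known to vanish only away from 0, so the polynomial is tested
    at the \<open>K + n + 1\<close> nonzero points 1, 2, and so on.\<close>
  have G: "comb_poly c = 0"
  proof (rule poly_eqI_degree[where A = "(\<lambda>k. of_nat (Suc k)) ` {..K + n}"])
    fix x assume "x \<in> (\<lambda>k. of_nat (Suc k) :: complex) ` {..K + n}"
    then have "x \<noteq> 0" by (auto simp del: of_nat_Suc)
    then show "poly (comb_poly c) x = poly 0 x" by (simp add: poly_comb_poly 0)
  next
    have "inj_on (\<lambda>k. of_nat (Suc k) :: complex) {..K + n}"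
      by (auto simp: inj_on_def)
    then have "card ((\<lambda>k. of_nat (Suc k) :: complex) ` {..K + n}) = Suc (K + n)"
      by (simp add: card_image)
    then show "degree (comb_poly c) < card ((\<lambda>k. of_nat (Suc k) :: complex) ` {..K + n})"
      "degree 0 < card ((\<lambda>k. of_nat (Suc k) :: complex) ` {..K + n})"
      using degree_comb_poly[of c] by auto
  qed
  define m where "m = Max {i. i < N \<and> c i \<noteq> 0}"
  have fin: "finite {i. i < N \<and> c i \<noteq> 0}" by simp
  have "m \<in> {i. i < N \<and> c i \<noteq> 0}"
    unfolding m_def by (rule Max_in[OF fin]) (use i ci in blast)
  then have m: "m < N" "c m \<noteq> 0" by auto
  have above: "c k = 0" if "m < k" "k < N" for k
    using Max_ge[OF fin, of k] that unfolding m_def by (metis (mono_tags) leD mem_Collect_eq)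
  \<comment> \<open>In the first case \<open>e\<close> is the power at which the constant
    coefficient of \<open>p\<close> enters term \<open>m\<close>; in the second it is the degree of
    that term.\<close>
  define e where "e = (if L < m then K - (m - L) else K + (n - L + m))"
  have lower: "coeff (monom 1 (K - (k - L)) * p (n - L + k)) e = 0" if "k < m" for k
  proof (cases "L < m")
    case True
    then have "e < K - (k - L)" using that m(1) by (auto simp: e_def)
    then show ?thesis by (simp add: coeff_monom_mult)
  next
    case False
    then show ?thesis
      using that by (simp add: coeff_monom_mult e_def) (intro coeff_eq_0, simp add: degree_p)
  qed
  have "coeff (comb_poly c) e =
      (\<Sum>k<N. c k * coeff (monom 1 (K - (k - L)) * p (n - L + k)) e)"
    by (simp add: comb_poly_def coeff_sum)
  also have "\<dots> = (\<Sum>k\<in>{m}. c k * coeff (monom 1 (K - (k - L)) * p (n - L + k)) e)"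
  proof (rule sum.mono_neutral_right)
    show "\<forall>k\<in>{..<N} - {m}. c k * coeff (monom 1 (K - (k - L)) * p (n - L + k)) e = 0"
    proof
      fix k assume "k \<in> {..<N} - {m}"
      then have "k < m \<or> c k = 0" using above by (cases "k < m") auto
      then show "c k * coeff (monom 1 (K - (k - L)) * p (n - L + k)) e = 0" using lower by auto
    qed
  qed (use m in auto)
  also have "\<dots> \<noteq> 0"
  proof (cases "L < m")
    case True
    then show ?thesis
      using m p_0 by (simp add: coeff_monom_mult e_def poly_0_coeff_0)
  next
    case False
    have "coeff (p (n - L + m)) (n - L + m) \<noteq> 0"
      using p_0 degree_p by (metis leading_coeff_0_iff poly_0)
    then show ?thesis using False m by (simp add: coeff_monom_mult e_def)
  qed
  finally show False using G by simp
qed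

lemma circle_weight_entry:
  "circle_weight (\<lambda>\<zeta>. c i * (u \<zeta> * poly (p m) \<zeta> * (1 / \<zeta>) ^ j))"
  by (intro circle_weight_cmult circle_weight_mult_power_inverse circle_weight_mult_poly u)

lemma beta_circle: "j \<in> {1..L} \<Longrightarrow> \<beta> j \<notin> sphere 0 1"
  using beta(2) by blast

lemma mult_comb:
  "u \<zeta> * comb c \<zeta> = (\<Sum>i<N. c i * (u \<zeta> * poly (p (n - L + i)) \<zeta> * (1 / \<zeta>) ^ (i - L)))"
  unfolding comb_def sum_distrib_left by (intro sum.cong refl) (simp add: mult_ac)

lemma circle_weight_comb: "circle_weight (\<lambda>\<zeta>. u \<zeta> * comb c \<zeta>)"
  unfolding mult_comb by (intro circle_weight_sum circle_weight_entry)

text \<open>Entry \<open>i\<close> brings \<open>n - L + i\<close> relations and loses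
  \<open>i - L\<close> of them to its negative power of \<zeta>; at least \<open>n - L\<close>
  remain.\<close>

lemma ortho_comb: "ortho (\<lambda>\<zeta>. u \<zeta> * comb c \<zeta>) (n - L)"
  unfolding ortho_def
proof (intro allI impI)
  fix k assume k: "k < n - L"
  have "circle_int (\<lambda>\<zeta>. u \<zeta> * comb c \<zeta> * (1 / \<zeta>) ^ k) =
      circle_int (\<lambda>\<zeta>. \<Sum>i<N. c i * (u \<zeta> * poly (p (n - L + i)) \<zeta> * (1 / \<zeta>) ^ (i - L + k)))"
    unfolding mult_comb sum_distrib_right power_add by (simp only: mult.assoc)
  also have "\<dots> =
      (\<Sum>i<N. circle_int (\<lambda>\<zeta>. c i * (u \<zeta> * poly (p (n - L + i)) \<zeta> * (1 / \<zeta>) ^ (i - L + k))))"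
    by (intro circle_int_sum circle_weight_entry) simp
  also have "\<dots> = 0"
    unfolding circle_int_cmult using k
    by (intro sum.neutral ballI) (simp add: orthoD[OF ortho_p] del: power_one_over)
  finally show "circle_int (\<lambda>\<zeta>. u \<zeta> * comb c \<zeta> * (1 / \<zeta>) ^ k) = 0" .
qed

text \<open>By \<open>cauchy_shift\<close> the negative powers come out entry by entry, so the
  transform of a combination is the same combination of the transformed row.\<close>

lemma cauchy_comb:
  assumes z: "z \<notin> sphere 0 1" "z \<noteq> 0"
  shows "cauchy (\<lambda>\<zeta>. u \<zeta> * comb c \<zeta>) z =
    (\<Sum>i<N. c i * ((1 / z) ^ (i - L) * cauchy (\<lambda>\<zeta>. u \<zeta> * poly (p (n - L + i)) \<zeta>) z))"
proof -
  have "cauchy (\<lambda>\<zeta>. u \<zeta> * comb c \<zeta>) z =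
      (\<Sum>i<N. cauchy (\<lambda>\<zeta>. c i * (u \<zeta> * poly (p (n - L + i)) \<zeta> * (1 / \<zeta>) ^ (i - L))) z)"
    unfolding mult_comb by (intro cauchy_sum circle_weight_entry z) simp
  also have "\<dots> = (\<Sum>i<N. c i * ((1 / z) ^ (i - L) * cauchy (\<lambda>\<zeta>. u \<zeta> * poly (p (n - L + i)) \<zeta>) z))"
  proof (intro sum.cong refl)
    fix i assume "i \<in> {..<N}"
    have "cauchy (\<lambda>\<zeta>. u \<zeta> * poly (p (n - L + i)) \<zeta> * (1 / \<zeta>) ^ (i - L)) z =
        cauchy (\<lambda>\<zeta>. u \<zeta> * poly (p (n - L + i)) \<zeta>) z / z ^ (i - L)"
      by (intro cauchy_shift circle_weight_mult_poly u z ortho_mono[OF ortho_p]) simp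
    then show "cauchy (\<lambda>\<zeta>. c i * (u \<zeta> * poly (p (n - L + i)) \<zeta> * (1 / \<zeta>) ^ (i - L))) z =
        c i * ((1 / z) ^ (i - L) * cauchy (\<lambda>\<zeta>. u \<zeta> * poly (p (n - L + i)) \<zeta>) z)"
      unfolding cauchy_cmult by (simp add: power_one_over)
  qed
  finally show ?thesis .
qed

text \<open>Polynomial division by the \<alpha> factors leaves \<open>R\<close> of degree at most
  \<open>n\<close>. The \<open>L\<close> distinct zeros of the Cauchy transform raise the
  \<open>n - L\<close> relations of \<open>ortho_comb\<close> to \<open>n\<close> after division by
  the \<beta> product, and \<open>unique\<close> identifies \<open>R\<close>.\<close>

lemma comb_eq_multiple:
  assumes a: "\<And>j. j \<in> {1..K} \<Longrightarrow> comb c (\<alpha> j) = 0"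
    and b: "\<And>j. j \<in> {1..L} \<Longrightarrow> cauchy (\<lambda>\<zeta>. u \<zeta> * comb c \<zeta>) (\<beta> j) = 0"
  shows "\<exists>t. \<forall>z. z \<noteq> 0 \<longrightarrow> comb c z = t * (node_prod K \<alpha> z * poly P z)"
proof -
  let ?A = "\<Prod>j=1..K. [:- \<alpha> j, 1:]"
  have "?A dvd comb_poly c"
    using alpha a by (intro linear_factors_dvd) (auto simp: poly_comb_poly)
  then obtain R where R: "comb_poly c = ?A * R" by (elim dvdE)
  have A: "?A \<noteq> 0" by (auto simp: prod_zero_iff)
  have "degree R \<le> n"
  proof (cases "R = 0")
    case False
    then have "degree (comb_poly c) = K + degree R"
      unfolding R using A by (subst degree_mult_eq) (simp_all add: degree_prod_linear)
    then show ?thesis using degree_comb_poly[of c] by simp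
  qed simp
  have combR: "comb c z = node_prod K \<alpha> z * poly R z" if "z \<noteq> 0" for z
  proof -
    have "z ^ K * comb c z = z ^ K * (node_prod K \<alpha> z * poly R z)"
      using arg_cong[OF R, of "\<lambda>q. poly q z"] that node_prod_eq[OF that, of K \<alpha>]
      by (simp add: poly_comb_poly poly_prod mult.assoc[symmetric])
    then show ?thesis using that by simp
  qed
  have "ortho (\<lambda>\<zeta>. u \<zeta> * comb c \<zeta> / (\<Prod>b\<in>\<beta> ` {1..L}. 1 - b / \<zeta>)) (n - L + card (\<beta> ` {1..L}))"
    using beta b by (intro ortho_divide_nodes circle_weight_comb ortho_comb) auto
  moreover have "n - L + card (\<beta> ` {1..L}) = n"
    using beta(1) n by (simp add: card_image)
  moreover have "(\<Prod>b\<in>\<beta> ` {1..L}. 1 - b / \<zeta>) = node_prod L \<beta> \<zeta>" for \<zeta>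
    using beta(1) by (simp add: prod.reindex node_prod_def)
  ultimately have o: "ortho (\<lambda>\<zeta>. u \<zeta> * comb c \<zeta> / node_prod L \<beta> \<zeta>) n"
    by simp
  have eq: "u \<zeta> * comb c \<zeta> / node_prod L \<beta> \<zeta> = wh \<zeta> * poly R \<zeta>" if "\<zeta> \<in> sphere 0 1" for \<zeta>
    using combR[OF sphere_nonzero[OF that]] by (simp add: modified_weight_def)
  have "ortho (\<lambda>\<zeta>. wh \<zeta> * poly R \<zeta>) n"
    by (rule iffD1[OF ortho_cong o]) (rule eq)
  then obtain t where "R = Polynomial.smult t P"
    using unique \<open>degree R \<le> n\<close> by blast
  then show ?thesis using combR by auto
qed

text \<open>On the circle, \<open>u * comb c\<close> is \<open>t * wh * P\<close> times the \<beta>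
  product. That product leaves the transform by \<open>cauchy_node_prod\<close>, using
  \<open>L \<le> n\<close> of the relations in \<open>ortho_P\<close>.\<close>

lemma cauchy_comb_multiple:
  assumes c: "\<forall>z. z \<noteq> 0 \<longrightarrow> comb c z = t * (node_prod K \<alpha> z * poly P z)"
    and z: "z \<notin> sphere 0 1" "z \<noteq> 0"
  shows "cauchy (\<lambda>\<zeta>. u \<zeta> * comb c \<zeta>) z =
    t * (node_prod L \<beta> z * cauchy (\<lambda>\<zeta>. wh \<zeta> * poly P \<zeta>) z)"
proof -
  have "cauchy (\<lambda>\<zeta>. u \<zeta> * comb c \<zeta>) z =
      cauchy (\<lambda>\<zeta>. t * (wh \<zeta> * poly P \<zeta> * node_prod L \<beta> \<zeta>)) z"
  proof (rule cauchy_cong)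
    fix \<zeta> :: complex assume *: "\<zeta> \<in> sphere 0 1"
    have "\<zeta> \<noteq> 0" using * by auto
    then show "u \<zeta> * comb c \<zeta> = t * (wh \<zeta> * poly P \<zeta> * node_prod L \<beta> \<zeta>)"
      using c node_prod_nonzero_on_circle[OF beta_circle *] by (simp add: modified_weight_def)
  qed
  also have "\<dots> = t * (node_prod L \<beta> z * cauchy (\<lambda>\<zeta>. wh \<zeta> * poly P \<zeta>) z)"
    unfolding cauchy_cmult using n
    by (subst cauchy_node_prod[OF z])
      (auto intro!: circle_weight_mult_poly circle_weight_modified_weight u beta_circle
        ortho_mono[OF ortho_P])
  finally show ?thesis .
qed

text \<open>At a point where \<open>node_prod K \<alpha> * P\<close> does not vanish, the determinant is nonzero, since a
  kernel vector would give a vanishing multiple of this function. Hence the cofactors of the first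
  row are a nonzero vector annihilated by all other rows.\<close>

lemma node_prod_mult_poly_eq_row_det:
  fixes e :: "complex \<Rightarrow> complex" and q :: "nat \<Rightarrow> complex \<Rightarrow> complex"
  assumes e: "\<And>z. z \<noteq> 0 \<Longrightarrow> e z \<noteq> 0"
    and q: "\<And>m z. z \<noteq> 0 \<Longrightarrow> z \<notin> sphere 0 1 \<Longrightarrow>
      q m z = e z * cauchy (\<lambda>\<zeta>. u \<zeta> * poly (p m) \<zeta>) z"
  defines "f \<equiv> \<lambda>m. poly (p m)"
  shows "\<exists>C. \<forall>z. z \<noteq> 0 \<longrightarrow>
    node_prod K \<alpha> z * poly P z = C * row_det K L n \<alpha> \<beta> f q f z \<and>
    (z \<notin> sphere 0 1 \<longrightarrow>
      node_prod L \<beta> z * (e z * cauchy (\<lambda>\<zeta>. wh \<zeta> * poly P \<zeta>) z) =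
        C * row_det K L n \<alpha> \<beta> f q q z)"
proof -
  \<comment> \<open>Both determinants have these lower rows, hence the same first-row cofactors;
    this is why a single constant serves both formulas.\<close>
  define rs where "rs = map (\<lambda>j. det_row K L n f (\<alpha> j)) [1..<K+1] @
    map (\<lambda>j. \<beta> j powi (- int n) \<cdot>\<^sub>v det_row K L n q (\<beta> j)) [1..<L+1]"
  have len: "length rs = K + L" by (simp add: rs_def)
  have dim: "set rs \<subseteq> carrier_vec (Suc (K + L))" by (auto simp: rs_def det_row_def)
  have det: "row_det K L n \<alpha> \<beta> f q a z =
      Determinant.det (mat_of_rows (Suc (K + L)) (det_row K L n a z # rs))" for a z
    by (simp add: row_det_def rs_def)
  have row_f: "(\<Sum>i<Suc (K + L). c i * vec_index (det_row K L n f z) i) = comb c z" for c z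
    unfolding comb_def f_def by (intro sum.cong) (simp_all add: det_row_index)
  have row_q: "(\<Sum>i<Suc (K + L). c i * vec_index (det_row K L n q z) i) =
      e z * cauchy (\<lambda>\<zeta>. u \<zeta> * comb c \<zeta>) z" if "z \<noteq> 0" "z \<notin> sphere 0 1" for c z
    unfolding cauchy_comb[OF that(2,1)] sum_distrib_left
    by (intro sum.cong) (simp_all add: det_row_index q[OF that] mult_ac)
  have kernel: "\<exists>t. \<forall>z. z \<noteq> 0 \<longrightarrow> comb c z = t * (node_prod K \<alpha> z * poly P z)"
    if "\<forall>r\<in>set rs. (\<Sum>i<Suc (K + L). c i * vec_index r i) = 0" for c
  proof (rule comb_eq_multiple)
    fix j assume j: "j \<in> {1..K}"
    then have "det_row K L n f (\<alpha> j) \<in> set rs" by (auto simp: rs_def simp del: upt_Suc)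
    then show "comb c (\<alpha> j) = 0" using that row_f by metis
  next
    fix j assume j: "j \<in> {1..L}"
    then have b: "\<beta> j \<noteq> 0" "\<beta> j \<notin> sphere 0 1" using beta(2) by auto
    have "\<beta> j powi (- int n) \<cdot>\<^sub>v det_row K L n q (\<beta> j) \<in> set rs"
      using j by (auto simp: rs_def simp del: upt_Suc)
    \<comment> \<open>The row scaling and \<open>e (\<beta> j)\<close> are nonzero, so the vanishing
      must come from the Cauchy transform.\<close>
    then have "0 =
        (\<Sum>i<Suc (K + L). c i * vec_index (\<beta> j powi (- int n) \<cdot>\<^sub>v det_row K L n q (\<beta> j)) i)"
      using that by metis
    also have "\<dots> =
        \<beta> j powi (- int n) * (\<Sum>i<Suc (K + L). c i * vec_index (det_row K L n q (\<beta> j)) i)"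
      unfolding sum_distrib_left by (intro sum.cong) (auto simp: det_row_def)
    finally show "cauchy (\<lambda>\<zeta>. u \<zeta> * comb c \<zeta>) (\<beta> j) = 0"
      unfolding row_q[OF b] using e[OF b(1)] b(1) by simp
  qed
  obtain z0 where z0: "z0 \<noteq> 0" "node_prod K \<alpha> z0 * poly P z0 \<noteq> 0"
  proof -
    have "finite ({0} \<union> \<alpha> ` {1..K} \<union> {z. poly P z = 0})"
      using poly_roots_finite[OF P(1)] by simp
    then obtain z where "z \<notin> {0} \<union> \<alpha> ` {1..K} \<union> {z. poly P z = 0}"
      using ex_new_if_finite[OF infinite_UNIV_char_0] by metis
    then have "z \<noteq> 0" "poly P z \<noteq> 0" "\<And>j. j \<in> {1..K} \<Longrightarrow> \<alpha> j \<noteq> z" by blast+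
    then show ?thesis using that[of z] node_prod_nonzero[of z K \<alpha>] by simp
  qed
  obtain c where c: "\<And>r. Determinant.det (mat_of_rows (Suc (K + L)) (r # rs)) =
      (\<Sum>i<Suc (K + L). c i * vec_index r i)"
    using det_mat_of_rows_Cons[OF len] by blast
  have "\<forall>r\<in>set rs. (\<Sum>i<Suc (K + L). c i * vec_index r i) = 0"
    using det_mat_of_rows_repeated[OF len dim] c by metis
  then obtain t where t: "\<forall>z. z \<noteq> 0 \<longrightarrow> comb c z = t * (node_prod K \<alpha> z * poly P z)"
    using kernel by blast
  have "t \<noteq> 0"
  proof
    assume "t = 0"
    then have "Determinant.det (mat_of_rows (Suc (K + L)) (det_row K L n f z0 # rs)) = 0"
      using t z0(1) by (simp only: c row_f) simp
    then obtain d where d: "\<exists>i<Suc (K + L). d i \<noteq> 0"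
      "\<forall>r\<in>set (det_row K L n f z0 # rs). (\<Sum>i<Suc (K + L). d i * vec_index r i) = 0"
      using det_mat_of_rows_kernel[of "det_row K L n f z0 # rs" "Suc (K + L)"] len by auto
    obtain s where s: "\<forall>z. z \<noteq> 0 \<longrightarrow> comb d z = s * (node_prod K \<alpha> z * poly P z)"
      using kernel[of d] d(2) by auto
    have "comb d z0 = 0"
      using d(2) row_f[of d z0] by (metis list.set_intros(1))
    then have "s = 0" using s z0 by auto
    then have "comb d z = 0" if "z \<noteq> 0" for z using s that by simp
    from comb_eq_0D[OF this] have "d i = 0" if "i < Suc (K + L)" for i
      using that by simp
    then show False using d(1) by blast
  qed
  show ?thesis
  \<comment> \<open>The determinant with first row from \<open>f\<close> is \<open>comb c\<close>,
    that is, \<open>t\<close> times the left-hand side; its Cauchy transform gives the same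
    \<open>t\<close> for \<open>q\<close>.\<close>
  proof (intro exI[of _ "1 / t"] allI impI conjI)
    fix z :: complex assume z: "z \<noteq> 0"
    show "node_prod K \<alpha> z * poly P z = 1 / t * row_det K L n \<alpha> \<beta> f q f z"
      using t z \<open>t \<noteq> 0\<close> by (simp only: det c row_f) simp
    assume z': "z \<notin> sphere 0 1"
    show "node_prod L \<beta> z * (e z * cauchy (\<lambda>\<zeta>. wh \<zeta> * poly P \<zeta>) z) =
        1 / t * row_det K L n \<alpha> \<beta> f q q z"
      using \<open>t \<noteq> 0\<close> unfolding det c row_q[OF z z'] cauchy_comb_multiple[OF t z' z] by simp
  qed
qed

end

theorem corollary3p2:
  fixes w wh :: "complex \<Rightarrow> complex"
    and \<phi> \<phi>b \<Phi> \<Phi>b :: "nat \<Rightarrow> complex poly"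
    and \<phi>p \<phi>s \<xi> \<xi>s :: "nat \<Rightarrow> complex \<Rightarrow> complex"
    and K L n :: nat
    and \<alpha> \<beta> :: "nat \<Rightarrow> complex"
  assumes weight: "circle_weight w"
    and alpha: "inj_on \<alpha> {1..K}" "\<forall>j\<in>{1..K}. \<alpha> j \<noteq> 0"
    and beta: "inj_on \<beta> {1..L}" "\<forall>j\<in>{1..L}. \<beta> j \<noteq> 0 \<and> \<beta> j \<notin> sphere 0 1"
    and n: "L \<le> n"
    and wh: "wh = modified_weight K L \<alpha> \<beta> w"
    and system: "biorthogonal_system w \<phi> \<phi>b" "generic_system \<phi> \<phi>b"
    and modified_system: "biorthogonal_system wh \<Phi> \<Phi>b" "generic_system \<Phi> \<Phi>b"
    and notations: "\<phi>p = (\<lambda>m. poly (\<phi> m))" "\<phi>s = (\<lambda>m. poly (reciprocal \<phi>b m))"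
      "\<xi> = assoc w \<phi>" "\<xi>s = assoc_star w \<phi>b"
  shows "\<exists>C Cs. \<forall>z. z \<noteq> 0 \<longrightarrow>
           node_prod K \<alpha> z * poly (\<Phi> n) z = C * row_det K L n \<alpha> \<beta> \<phi>p \<xi> \<phi>p z \<and>
           node_prod K \<alpha> z * poly (reciprocal \<Phi>b n) z = Cs * row_det K L n \<alpha> \<beta> \<phi>s \<xi>s \<phi>s z \<and>
           (z \<notin> sphere 0 1 \<longrightarrow>
             node_prod L \<beta> z * assoc wh \<Phi> n z = C * row_det K L n \<alpha> \<beta> \<phi>p \<xi> \<xi> z \<and>
             node_prod L \<beta> z * assoc_star wh \<Phi>b n z = Cs * row_det K L n \<alpha> \<beta> \<phi>s \<xi>s \<xi>s z)"
proof -
  have whw: "circle_weight wh"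
    unfolding wh using weight beta by (intro circle_weight_modified_weight) auto
  note sys = weight system(1) and sysh = whw modified_system(1)
  have w': "circle_weight (\<lambda>\<zeta>. w \<zeta> / \<zeta>)"
    using circle_weight_mult_power_inverse[OF weight, of 1] by simp
  have wh': "modified_weight K L \<alpha> \<beta> (\<lambda>\<zeta>. w \<zeta> / \<zeta>) = (\<lambda>\<zeta>. wh \<zeta> / \<zeta>)"
    by (rule ext) (simp add: wh modified_weight_def)
  \<comment> \<open>Genericity covers the indices from 1 on; at index 0 the polynomials are nonzero
    constants.\<close>
  have nz: "poly (\<phi> m) 0 \<noteq> 0" "poly (\<phi>b m) 0 \<noteq> 0" for m
  proof (atomize (full), cases "m = 0")
    case True
    then show "poly (\<phi> m) 0 \<noteq> 0 \<and> poly (\<phi>b m) 0 \<noteq> 0"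
      using biorthogonal_lead[OF sys, of 0] biorthogonal_degree(3)[OF sys, of 0]
      by (simp add: poly_0_coeff_0)
  next
    case False
    then show "poly (\<phi> m) 0 \<noteq> 0 \<and> poly (\<phi>b m) 0 \<noteq> 0"
      using system(2) by (auto simp: generic_system_def refl_coeff_def Suc_le_eq)
  qed
  interpret D: darboux w K L n \<alpha> \<beta> \<phi> "\<Phi> n"
  proof
    show "ortho (\<lambda>\<zeta>. modified_weight K L \<alpha> \<beta> w \<zeta> * poly (\<Phi> n) \<zeta>) n"
      using ortho_biorthogonal[OF sysh] by (simp add: wh)
    show "\<exists>c. R = Polynomial.smult c (\<Phi> n)"
      if "ortho (\<lambda>\<zeta>. modified_weight K L \<alpha> \<beta> w \<zeta> * poly R \<zeta>) n" "degree R \<le> n" for R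
      using multiple_if_ortho[OF sysh] that by (simp add: wh)
  qed (use weight alpha beta n nz biorthogonal_degree[OF sys] ortho_biorthogonal[OF sys]
      biorthogonal_nonzero[OF sysh] biorthogonal_degree[OF sysh] in auto)
  interpret S: darboux "\<lambda>\<zeta>. w \<zeta> / \<zeta>" K L n \<alpha> \<beta> "reciprocal \<phi>b" "reciprocal \<Phi>b n"
  proof
    \<comment> \<open>Reflection preserves the degree because the constant term of
      \<open>\<phi>b m\<close> is nonzero.\<close>
    show "degree (reciprocal \<phi>b m) = m" for m
      using nz(2)[of m] biorthogonal_degree(2)[OF sys]
      by (simp add: reciprocal_def degree_reflect_poly_eq poly_0_coeff_0)
    show "poly (reciprocal \<phi>b m) 0 \<noteq> 0" for m
      using biorthogonal_nonzero(2)[OF sys] by (simp add: reciprocal_def poly_0_coeff_0)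
    show "reciprocal \<Phi>b n \<noteq> 0"
      using biorthogonal_nonzero(2)[OF sysh] by (simp add: reciprocal_def)
    show "degree (reciprocal \<Phi>b n) \<le> n"
      using degree_reflect_poly_le[of "\<Phi>b n"] biorthogonal_degree(2)[OF sysh]
      by (simp add: reciprocal_def)
    show "ortho (\<lambda>\<zeta>. modified_weight K L \<alpha> \<beta> (\<lambda>\<zeta>. w \<zeta> / \<zeta>) \<zeta> * poly (reciprocal \<Phi>b n) \<zeta>) n"
      unfolding wh' by (rule ortho_reciprocal[OF sysh])
    show "\<exists>c. R = Polynomial.smult c (reciprocal \<Phi>b n)"
      if "ortho (\<lambda>\<zeta>. modified_weight K L \<alpha> \<beta> (\<lambda>\<zeta>. w \<zeta> / \<zeta>) \<zeta> * poly R \<zeta>) n" "degree R \<le> n" for R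
      using multiple_reciprocal_if_ortho[OF sysh] that unfolding wh' by simp
  qed (use w' alpha beta n ortho_reciprocal[OF sys] in auto)
  \<comment> \<open>The factor \<open>e\<close> is 2 here and \<open>- 2 * z\<close> in the starred
    case, as dictated by the Cauchy representations of the associated functions; neither vanishes
    away from 0.\<close>
  obtain C where C: "\<forall>z. z \<noteq> 0 \<longrightarrow>
      node_prod K \<alpha> z * poly (\<Phi> n) z = C * row_det K L n \<alpha> \<beta> \<phi>p \<xi> \<phi>p z \<and>
      (z \<notin> sphere 0 1 \<longrightarrow>
        node_prod L \<beta> z * (2 * cauchy (\<lambda>\<zeta>. modified_weight K L \<alpha> \<beta> w \<zeta> * poly (\<Phi> n) \<zeta>) z) =
          C * row_det K L n \<alpha> \<beta> \<phi>p \<xi> \<xi> z)"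
    using D.node_prod_mult_poly_eq_row_det[of "\<lambda>_. 2" "\<xi>"] assoc_eq_cauchy[OF sys]
    unfolding notations by auto
  obtain Cs where Cs: "\<forall>z. z \<noteq> 0 \<longrightarrow>
      node_prod K \<alpha> z * poly (reciprocal \<Phi>b n) z = Cs * row_det K L n \<alpha> \<beta> \<phi>s \<xi>s \<phi>s z \<and>
      (z \<notin> sphere 0 1 \<longrightarrow>
        node_prod L \<beta> z * (- 2 * z * cauchy (\<lambda>\<zeta>. modified_weight K L \<alpha> \<beta> (\<lambda>\<zeta>. w \<zeta> / \<zeta>) \<zeta> *
          poly (reciprocal \<Phi>b n) \<zeta>) z) = Cs * row_det K L n \<alpha> \<beta> \<phi>s \<xi>s \<xi>s z)"
    using S.node_prod_mult_poly_eq_row_det[of "\<lambda>z. - 2 * z" "\<xi>s"] assoc_star_eq_cauchy[OF sys]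
    unfolding notations by auto
  show ?thesis
    using C Cs assoc_eq_cauchy[OF sysh] assoc_star_eq_cauchy[OF sysh]
    unfolding wh' wh[symmetric] by (intro exI[of _ C] exI[of _ Cs]) simp
qed

end
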